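(* For any potential $V\in\mathscr{C}$ and for all $N\ge 2$, the spectral gap of $\mathcal{L}=\mathcal{L}_{N,V}$ is given by $$\mathrm{gap}_N = 1-\cos\left(\frac{\pi}{N}\right),$$ and the function $$f_N(x)=\sum_{k=1}^{N-1}\sin\left(\frac{k\pi}{N}\right)x_k$$ is an eigenfunction of $\mathcal{L}$ with eigenvalue $-\mathrm{gap}_N$.
   Context: $\mathscr{C}$ denotes the set of functions $V:\mathbb{R}\to\mathbb{R}$ that are: (i) convex; (ii) of at most polynomial growth: there exist $C>0$, $K\ge 1$ such that $|V(x)|\le C(1+|x|)^K$ for all $x\in\mathbb{R}$; (iii) non-affine: $V'_+>V'_-$, where $V'_{\pm}:=\lim_{x\to\pm\infty}V(x)/x\in[-\infty,\infty]$. State space: $\Omega_N=\{(x_0,\dots,x_N)\in\mathbb{R}^{N+1}: x_0=0,\ x_N=0\}$. The probability measure $\pi_N$ on $\Omega_N$ has density $e^{-H(x)}/Z_N$ with respect to $\mathrm{d}x_1\cdots \mathrm{d}x_{N-1}$, where $H(x)=\sum_{k=1}^N V(x_k-x_{k-1})$ and $Z_N$ is the normalization constant. For $b,c\in\mathbb{R}$ let $\rho_{b,c}(u)=\dfrac{e^{-V(u-b)-V(c-u)}}{\int_{\mathbb{R}} e^{-V(s-b)-V(c-s)}\,\mathrm{d}s}$. For $1\le k\le N-1$, with $x^{(k,u)}$ the vector $x$ with $k$-th coordinate replaced by $u$, let $(\mathcal{Q}_kf)(x)=\int_{\mathbb{R}} f(x^{(k,u)})\rho_{x_{k-1},x_{k+1}}(u)\,\mathrm{d}u$.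 The generator of the Gibbs sampler is $\mathcal{L}f=\sum_{k=1}^{N-1}(\mathcal{Q}_kf-f)$, a bounded self-adjoint operator on $L^2=L^2(\Omega_N,\pi_N)$. Writing $\pi_N(f)=\int f\,\mathrm{d}\pi_N$, its spectral gap is $$\mathrm{gap}_N=\inf_{f\in L^2,\ f\neq 0,\ \pi_N(f)=0}\frac{\pi_N(f(-\mathcal{L}f))}{\pi_N(f^2)}.$$ *)

theory Defs
  imports "HOL-Analysis.Analysis"
begin

definition slope_at_top :: "(real \<Rightarrow> real) \<Rightarrow> ereal" where
  "slope_at_top V = Lim at_top (\<lambda>x. ereal (V x / x))"

definition slope_at_bot :: "(real \<Rightarrow> real) \<Rightarrow> ereal" where
  "slope_at_bot V = Lim at_bot (\<lambda>x. ereal (V x / x))"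

definition potentials :: "(real \<Rightarrow> real) set" where
  "potentials = {V. convex_on UNIV V
     \<and> (\<exists>C>0. \<exists>K\<ge>1. \<forall>x. \<bar>V x\<bar> \<le> C * (1 + \<bar>x\<bar>) powr K)
     \<and> slope_at_top V > slope_at_bot V}"

(* A vector (x_0, ..., x_N) is an extensional function on {0..N}, i.e. it takes the
   value undefined at every index greater than N. *)
definition Omega :: "nat \<Rightarrow> (nat \<Rightarrow> real) set" where
  "Omega N = {x \<in> {0..N} \<rightarrow>\<^sub>E UNIV. x 0 = 0 \<and> x N = 0}"

definition pin :: "nat \<Rightarrow> (nat \<Rightarrow> real) \<Rightarrow> nat \<Rightarrow> real" where
  "pin N y = (\<lambda>k\<in>{0..N}. if k \<in> {1..<N} then y k else 0)"

(* The reference measure dx_1 ... dx_(N-1) on Omega N: Lebesgue measure in the free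
   coordinates, carried over to Omega N by adding the two pinned coordinates. *)
definition reference_measure :: "nat \<Rightarrow> (nat \<Rightarrow> real) measure" where
  "reference_measure N =
     distr (Pi\<^sub>M {1..<N} (\<lambda>_. lborel))
       (restrict_space (Pi\<^sub>M {0..N} (\<lambda>_. borel)) (Omega N)) (pin N)"

definition hamiltonian :: "(real \<Rightarrow> real) \<Rightarrow> nat \<Rightarrow> (nat \<Rightarrow> real) \<Rightarrow> real" where
  "hamiltonian V N x = (\<Sum>k=1..N. V (x k - x (k - 1)))"

definition partition_function :: "(real \<Rightarrow> real) \<Rightarrow> nat \<Rightarrow> real" where
  "partition_function V N = (\<integral>x. exp (- hamiltonian V N x) \<partial>reference_measure N)"

definition gibbs :: "(real \<Rightarrow> real) \<Rightarrow> nat \<Rightarrow> (nat \<Rightarrow> real) measure" where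
  "gibbs V N = density (reference_measure N)
     (\<lambda>x. ennreal (exp (- hamiltonian V N x) / partition_function V N))"

definition rho :: "(real \<Rightarrow> real) \<Rightarrow> real \<Rightarrow> real \<Rightarrow> real \<Rightarrow> real" where
  "rho V b c u = exp (- V (u - b) - V (c - u)) / (\<integral>s. exp (- V (s - b) - V (c - s)) \<partial>lborel)"

definition resample ::
    "(real \<Rightarrow> real) \<Rightarrow> nat \<Rightarrow> ((nat \<Rightarrow> real) \<Rightarrow> real) \<Rightarrow> (nat \<Rightarrow> real) \<Rightarrow> real" where
  "resample V k f x = (\<integral>u. f (x(k := u)) * rho V (x (k - 1)) (x (k + 1)) u \<partial>lborel)"

definition generator ::
    "(real \<Rightarrow> real) \<Rightarrow> nat \<Rightarrow> ((nat \<Rightarrow> real) \<Rightarrow> real) \<Rightarrow> (nat \<Rightarrow> real) \<Rightarrow> real" where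
  "generator V N f x = (\<Sum>k=1..N-1. resample V k f x - f x)"

(* Representatives of the elements of the real space L^2: being zero and being equal
   are always meant almost everywhere below. *)
definition L2 :: "'a measure \<Rightarrow> ('a \<Rightarrow> real) set" where
  "L2 M = {f \<in> borel_measurable M. integrable M (\<lambda>x. (f x)\<^sup>2)}"

(* The infimum is taken in ereal so that it is a genuine infimum for every V and N. *)
definition spectral_gap :: "(real \<Rightarrow> real) \<Rightarrow> nat \<Rightarrow> ereal" where
  "spectral_gap V N =
     (INF f \<in> {f \<in> L2 (gibbs V N). \<not> (AE x in gibbs V N. f x = 0) \<and> (\<integral>x. f x \<partial>gibbs V N) = 0}.
        ereal ((\<integral>x. f x * (- generator V N f x) \<partial>gibbs V N) / (\<integral>x. (f x)\<^sup>2 \<partial>gibbs V N)))"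

definition eigenfunction ::
    "(real \<Rightarrow> real) \<Rightarrow> nat \<Rightarrow> real \<Rightarrow> ((nat \<Rightarrow> real) \<Rightarrow> real) \<Rightarrow> bool" where
  "eigenfunction V N l f \<longleftrightarrow>
     f \<in> L2 (gibbs V N) \<and> \<not> (AE x in gibbs V N. f x = 0) \<and>
     (AE x in gibbs V N. generator V N f x = l * f x)"

definition sine_mode :: "nat \<Rightarrow> (nat \<Rightarrow> real) \<Rightarrow> real" where
  "sine_mode N x = (\<Sum>k=1..N-1. sin (real k * pi / real N) * x k)"

end

theory Submission
  imports Defs "HOL-Probability.Probability"
begin

text \<open>
  Write \<open>T = \<Sum>\<^sub>k Q\<^sub>k\<close> and \<open>q = N - 2 + cos (\<pi> / N)\<close>, so that \<open>L = T - (N - 1)\<close>; the lower bound on the gap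
  says that \<open>T\<close> has norm at most \<open>q\<close> on mean-zero functions. By convexity of \<open>V\<close> the densities
  \<open>\<rho>\<^bsub>b,c\<^esub>\<close> are stochastically increasing in \<open>b\<close> and \<open>c\<close>, and their means are \<open>(b + c) / 2\<close>, so
  integrating an \<open>L\<close>-Lipschitz function against \<open>\<rho>\<^bsub>b,c\<^esub>\<close> gives an \<open>L / 2\<close>-Lipschitz function of \<open>b\<close> and
  of \<open>c\<close>. Since \<open>k \<mapsto> sin (k \<pi> / N)\<close> is an eigenvector of the discrete Laplacian, \<open>T\<close> therefore multiplies
  by at most \<open>q\<close> the Lipschitz constant for the weighted distance
  \<open>\<Sum>\<^sub>k sin (k \<pi> / N) \<bar>x\<^sub>k - y\<^sub>k\<bar>\<close>. Hence \<open>\<parallel>T\<^sup>n f\<parallel> = O(q\<^sup>n)\<close> for mean-zero Lipschitz \<open>f\<close>; as \<open>T\<close> is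
  symmetric, \<open>n \<mapsto> \<parallel>T\<^sup>n f\<parallel>\<close> is log-convex, which upgrades this to \<open>\<parallel>T f\<parallel> \<le> q \<parallel>f\<parallel>\<close>, and density of the
  Lipschitz functions extends the bound to all of \<open>L\<^sup>2\<close>. The sine mode attains it.
\<close>

section \<open>Square-integrable functions\<close>

text \<open>The Lipschitz contraction lives in another norm than the one in the gap, and the
  constant hidden in \<open>O(q^n)\<close> depends on \<open>f\<close>; by itself it gives only an
  exponential rate. Log-convexity removes that constant, so no spectral theorem, no compactness and
  no prior existence of eigenfunctions enters. The factor one half is optimal transport on the line:
  the transport cost between stochastically ordered laws is the difference of their means. It is
  used in dual form, by testing against the nondecreasing function \<open>L * u - g u\<close>, so no
  coupling has to be constructed. The sine weights vanish at \<open>0\<close> and \<open>N\<close>,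
  where configurations are pinned, and are positive in between. The first fact removes the boundary
  terms when neighbour averages are summed by parts; the second makes the weighted distance control
  every free coordinate, without which half-space indicators could not be approximated by Lipschitz
  functions.\<close>

definition l2norm :: "'a measure \<Rightarrow> ('a \<Rightarrow> real) \<Rightarrow> real" where
  "l2norm M f = sqrt (\<integral>x. (f x)\<^sup>2 \<partial>M)"

lemma L2_D:
  assumes "f \<in> L2 M"
  shows "f \<in> borel_measurable M" "integrable M (\<lambda>x. (f x)\<^sup>2)"
  using assms by (auto simp: L2_def)

lemma L2_dominated:
  assumes g: "g \<in> L2 M" and f: "f \<in> borel_measurable M"
    and le: "\<And>x. x \<in> space M \<Longrightarrow> \<bar>f x\<bar> \<le> \<bar>g x\<bar>"
  shows "f \<in> L2 M"
proof -
  have "integrable M (\<lambda>x. (f x)\<^sup>2)"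
  proof (rule Bochner_Integration.integrable_bound[OF L2_D(2)[OF g]])
    show "AE x in M. norm ((f x)\<^sup>2) \<le> norm ((g x)\<^sup>2)"
      using le by (auto simp: abs_le_square_iff)
  qed (use f in measurable)
  with f show ?thesis by (simp add: L2_def)
qed

lemma integrable_L2_mult:
  assumes f: "f \<in> L2 M" and g: "g \<in> L2 M"
  shows "integrable M (\<lambda>x. f x * g x)"
proof (rule Bochner_Integration.integrable_bound)
  note [measurable] = L2_D(1)[OF f] L2_D(1)[OF g]
  show "integrable M (\<lambda>x. (f x)\<^sup>2 + (g x)\<^sup>2)"
    using L2_D(2)[OF f] L2_D(2)[OF g] by simp
  show "(\<lambda>x. f x * g x) \<in> borel_measurable M" by measurable
  have "\<bar>a * b\<bar> \<le> \<bar>a\<^sup>2 + b\<^sup>2\<bar>" for a b :: real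
  proof -
    have "2 * (\<bar>a\<bar> * \<bar>b\<bar>) \<le> a\<^sup>2 + b\<^sup>2"
      using sum_squares_bound[of "\<bar>a\<bar>" "\<bar>b\<bar>"] by simp
    moreover have "0 \<le> \<bar>a\<bar> * \<bar>b\<bar>" by simp
    ultimately show ?thesis unfolding abs_mult by linarith
  qed
  then show "AE x in M. norm (f x * g x) \<le> norm ((f x)\<^sup>2 + (g x)\<^sup>2)" by simp
qed

lemma L2_scale:
  assumes f: "f \<in> L2 M"
  shows "(\<lambda>x. c * f x) \<in> L2 M"
  using L2_D[OF f] by (auto simp: L2_def power_mult_distrib)

lemma L2_add:
  assumes f: "f \<in> L2 M" and g: "g \<in> L2 M"
  shows "(\<lambda>x. f x + g x) \<in> L2 M"
  using L2_D[OF f] L2_D[OF g] integrable_L2_mult[OF f g]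
  by (auto simp: L2_def power2_sum mult.assoc)

lemma L2_diff:
  assumes f: "f \<in> L2 M" and g: "g \<in> L2 M"
  shows "(\<lambda>x. f x - g x) \<in> L2 M"
  using L2_add[OF f L2_scale[OF g, of "-1"]] by simp

lemma L2_sum:
  assumes "\<And>i. i \<in> I \<Longrightarrow> f i \<in> L2 M"
  shows "(\<lambda>x. \<Sum>i\<in>I. f i x) \<in> L2 M"
  using assms
proof (induction I rule: infinite_finite_induct)
  case (insert i I)
  then show ?case using L2_add[of "f i" M "\<lambda>x. \<Sum>i\<in>I. f i x"] by simp
qed (auto simp: L2_def)

lemma (in finite_measure) L2_bounded:
  assumes f: "f \<in> borel_measurable M" and "\<And>x. x \<in> space M \<Longrightarrow> \<bar>f x\<bar> \<le> B"
  shows "f \<in> L2 M"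
proof (rule L2_dominated[OF _ f])
  show "(\<lambda>_. B) \<in> L2 M" by (simp add: L2_def)
qed (use assms(2) in fastforce)

lemma (in finite_measure) L2_const: "(\<lambda>_. c) \<in> L2 M"
  by (rule L2_bounded[where B = "\<bar>c\<bar>"]) auto

lemma (in finite_measure) integrable_L2:
  assumes f: "f \<in> L2 M"
  shows "integrable M f"
  using integrable_L2_mult[OF f L2_const[of 1]] by simp

lemma l2norm_nonneg [simp]: "0 \<le> l2norm M f"
  by (simp add: l2norm_def)

lemma l2norm_sq: "(l2norm M f)\<^sup>2 = (\<integral>x. (f x)\<^sup>2 \<partial>M)"
  by (simp add: l2norm_def)

lemma Cauchy_Schwarz_L2:
  assumes f: "f \<in> L2 M" and g: "g \<in> L2 M"
  shows "\<bar>\<integral>x. f x * g x \<partial>M\<bar> \<le> l2norm M f * l2norm M g"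
proof -
  define a b c where "a = (\<integral>x. (f x)\<^sup>2 \<partial>M)" and "b = (\<integral>x. f x * g x \<partial>M)"
    and "c = (\<integral>x. (g x)\<^sup>2 \<partial>M)"
  have q: "0 \<le> a + 2 * t * b + t\<^sup>2 * c" for t
  proof -
    have "0 \<le> (\<integral>x. (f x + t * g x)\<^sup>2 \<partial>M)" by simp
    also have "(\<lambda>x. (f x + t * g x)\<^sup>2) = (\<lambda>x. (f x)\<^sup>2 + (2 * t) * (f x * g x) + t\<^sup>2 * (g x)\<^sup>2)"
      by (simp add: power2_eq_square algebra_simps)
    also have "(\<integral>x. (f x)\<^sup>2 + (2 * t) * (f x * g x) + t\<^sup>2 * (g x)\<^sup>2 \<partial>M) = a + 2 * t * b + t\<^sup>2 * c"
      using L2_D(2)[OF f] L2_D(2)[OF g] integrable_L2_mult[OF f g]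
      unfolding a_def b_def c_def
      by (simp only: Bochner_Integration.integral_add integral_mult_right_zero
          Bochner_Integration.integrable_add integrable_mult_right)
    finally show ?thesis .
  qed
  have "b\<^sup>2 \<le> a * c"
  proof (cases "c = 0")
    case True
    have "b = 0"
    proof (rule ccontr)
      assume "b \<noteq> 0"
      \<comment> \<open>With \<open>c = 0\<close> the quadratic is affine in \<open>t\<close>, and
        this \<open>t\<close> gives it the value \<open>-1\<close>.\<close>
      then show False using q[of "- (a + 1) / (2 * b)"] True by (simp add: field_simps)
    qed
    then show ?thesis using True by simp
  next
    case False
    then have c: "c > 0" by (simp add: c_def less_le)
    have "0 \<le> a - b\<^sup>2 / c"
      using q[of "- b / c"] c by (simp add: power2_eq_square field_simps)
    then show ?thesis using c by (simp add: field_simps)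
  qed
  then have "\<bar>b\<bar> \<le> sqrt (a * c)" by (simp add: real_le_rsqrt)
  then show ?thesis by (simp add: l2norm_def real_sqrt_mult a_def b_def c_def)
qed

lemma l2norm_triangle:
  assumes f: "f \<in> L2 M" and g: "g \<in> L2 M"
  shows "l2norm M (\<lambda>x. f x + g x) \<le> l2norm M f + l2norm M g"
proof (rule power2_le_imp_le)
  have "(l2norm M (\<lambda>x. f x + g x))\<^sup>2
      = (\<integral>x. (f x)\<^sup>2 \<partial>M) + (\<integral>x. (g x)\<^sup>2 \<partial>M) + 2 * (\<integral>x. f x * g x \<partial>M)"
    using L2_D(2)[OF f] L2_D(2)[OF g] integrable_L2_mult[OF f g]
    by (simp add: l2norm_sq power2_sum mult.assoc)
  also have "\<dots> \<le> (l2norm M f)\<^sup>2 + (l2norm M g)\<^sup>2 + 2 * (l2norm M f * l2norm M g)"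
    using Cauchy_Schwarz_L2[OF f g] by (simp add: l2norm_sq)
  finally show "(l2norm M (\<lambda>x. f x + g x))\<^sup>2 \<le> (l2norm M f + l2norm M g)\<^sup>2"
    by (simp add: power2_sum algebra_simps)
qed simp

lemma l2norm_scale: "l2norm M (\<lambda>x. c * f x) = \<bar>c\<bar> * l2norm M f"
  by (simp add: l2norm_def power_mult_distrib real_sqrt_mult)

lemma l2norm_minus_commute: "l2norm M (\<lambda>x. f x - g x) = l2norm M (\<lambda>x. g x - f x)"
  by (simp add: l2norm_def power2_commute)

lemma l2norm_sum:
  assumes "finite I" "\<And>i. i \<in> I \<Longrightarrow> f i \<in> L2 M"
  shows "l2norm M (\<lambda>x. \<Sum>i\<in>I. f i x) \<le> (\<Sum>i\<in>I. l2norm M (f i))"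
  using assms
proof (induction I rule: finite_induct)
  case empty
  then show ?case by (simp add: l2norm_def)
next
  case (insert i I)
  have "l2norm M (\<lambda>x. f i x + (\<Sum>i\<in>I. f i x)) \<le> l2norm M (f i) + l2norm M (\<lambda>x. \<Sum>i\<in>I. f i x)"
    using insert by (intro l2norm_triangle L2_sum) auto
  also have "\<dots> \<le> l2norm M (f i) + (\<Sum>i\<in>I. l2norm M (f i))"
    using insert by simp
  finally show ?case using insert by simp
qed

lemma l2norm_cong_AE:
  assumes "AE x in M. f x = g x" "f \<in> borel_measurable M" "g \<in> borel_measurable M"
  shows "l2norm M f = l2norm M g"
  unfolding l2norm_def using assms by (intro arg_cong[where f=sqrt] integral_cong_AE) auto

lemma l2norm_mono:
  assumes g: "g \<in> L2 M" and f: "f \<in> borel_measurable M"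
    and le: "\<And>x. x \<in> space M \<Longrightarrow> \<bar>f x\<bar> \<le> \<bar>g x\<bar>"
  shows "l2norm M f \<le> l2norm M g"
  unfolding l2norm_def
proof (intro real_sqrt_le_mono integral_mono)
  show "integrable M (\<lambda>x. (f x)\<^sup>2)" using L2_dominated[OF g f le] by (simp add: L2_D)
  show "integrable M (\<lambda>x. (g x)\<^sup>2)" using g by (simp add: L2_D)
qed (use le in \<open>simp add: abs_le_square_iff\<close>)

text \<open>Removing the mean is an orthogonal projection. It lets an approximant of a mean-zero
  function be recentred without increasing the error.\<close>

lemma (in prob_space) l2norm_center_le:
  assumes f: "f \<in> L2 M"
  shows "l2norm M (\<lambda>x. f x - (\<integral>x. f x \<partial>M)) \<le> l2norm M f"
proof (rule power2_le_imp_le)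
  have "(l2norm M (\<lambda>x. f x - expectation f))\<^sup>2 = variance f"
    by (simp add: l2norm_sq)
  also have "\<dots> \<le> (l2norm M f)\<^sup>2"
    using variance_eq[OF integrable_L2[OF f] L2_D(2)[OF f]] by (simp add: l2norm_sq)
  finally show "(l2norm M (\<lambda>x. f x - expectation f))\<^sup>2 \<le> (l2norm M f)\<^sup>2" .
qed simp

section \<open>From asymptotic decay to a one-step norm bound\<close>

text \<open>Log-convexity makes the ratios of consecutive terms nondecreasing. A first ratio
  \<open>r > q\<close> would therefore persist and force growth of order \<open>r ^ n\<close>,
  against the bound of order \<open>q ^ n\<close>. The size of \<open>C\<close> is irrelevant, which
  is the point of the lemma.\<close>

lemma log_convex_geometric_bound:
  fixes a :: "nat \<Rightarrow> real"
  assumes nonneg: "\<And>n. 0 \<le> a n" and convex: "\<And>n. (a (Suc n))\<^sup>2 \<le> a n * a (Suc (Suc n))"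
    and bound: "\<And>n. a n \<le> C * q ^ n" and q: "0 \<le> q"
  shows "a 1 \<le> q * a 0"
proof (cases "a 0 = 0")
  case True
  then show ?thesis using convex[of 0] by simp
next
  case False
  then have a0: "a 0 > 0" using nonneg[of 0] by linarith
  show ?thesis
  proof (rule ccontr)
    assume not: "\<not> a 1 \<le> q * a 0"
    define r where "r = a 1 / a 0"
    have r: "r > q" using not a0 by (simp add: r_def field_simps)
    with q have r0: "r > 0" by simp
    have step: "a n > 0 \<and> a (Suc n) \<ge> r * a n" for n
    proof (induction n)
      case 0
      then show ?case using a0 by (simp add: r_def)
    next
      case (Suc n)
      then have n: "a n > 0" "a (Suc n) \<ge> r * a n" by auto
      then have p: "a (Suc n) > 0" using r0 by (meson less_le_trans mult_pos_pos)
      have "r * a n * a (Suc n) \<le> a (Suc n) * a (Suc n)"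
        using n p by (intro mult_right_mono) auto
      also have "\<dots> \<le> a n * a (Suc (Suc n))"
        using convex[of n] by (simp add: power2_eq_square)
      finally have "a n * (r * a (Suc n)) \<le> a n * a (Suc (Suc n))" by (simp add: algebra_simps)
      then show ?case using n(1) p by simp
    qed
    have low: "a n \<ge> r ^ n * a 0" for n
    proof (induction n)
      case (Suc n)
      have "r ^ Suc n * a 0 \<le> r * a n" using Suc r0 by simp
      then show ?case using step[of n] by simp
    qed simp
    have "a 0 \<le> C * (q / r) ^ n" for n
    proof -
      have "r ^ n * a 0 \<le> C * q ^ n" using low[of n] bound[of n] by linarith
      then show ?thesis using r0 by (simp add: power_divide field_simps)
    qed
    moreover have "(\<lambda>n. C * (q / r) ^ n) \<longlonglongrightarrow> C * 0"
      using r r0 q by (intro tendsto_mult tendsto_const LIMSEQ_realpow_zero) auto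
    ultimately have "a 0 \<le> C * 0" by (intro LIMSEQ_le_const) auto
    with a0 show False by simp
  qed
qed

text \<open>The decay hypothesis concerns only the dense class \<open>D\<close> and allows a
  constant depending on the function; symmetry turns it into a uniform bound on \<open>D\<close>.
  The crude bound \<open>K\<close> serves only to carry that bound to the closure. Additivity is
  assumed almost everywhere because that is all an integral operator on representatives
  satisfies.\<close>

lemma (in prob_space) symmetric_contraction_from_dense:
  fixes T :: "('a \<Rightarrow> real) \<Rightarrow> 'a \<Rightarrow> real"
  assumes L2: "\<And>f. f \<in> L2 M \<Longrightarrow> T f \<in> L2 M"
    and bounded: "\<And>f. f \<in> L2 M \<Longrightarrow> l2norm M (T f) \<le> K * l2norm M f"
    and symmetric: "\<And>f g. f \<in> L2 M \<Longrightarrow> g \<in> L2 M \<Longrightarrow>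
      (\<integral>x. f x * T g x \<partial>M) = (\<integral>x. T f x * g x \<partial>M)"
    and additive: "\<And>f g. f \<in> L2 M \<Longrightarrow> g \<in> L2 M \<Longrightarrow>
      AE x in M. T (\<lambda>x. f x + g x) x = T f x + T g x"
    and D: "D \<subseteq> L2 M"
    and dense: "\<And>f e. f \<in> L2 M \<Longrightarrow> 0 < e \<Longrightarrow> \<exists>g\<in>D. l2norm M (\<lambda>x. f x - g x) < e"
    and D_diff: "\<And>f c. f \<in> D \<Longrightarrow> (\<lambda>x. f x - c) \<in> D"
    and decay: "\<And>f. f \<in> D \<Longrightarrow> (\<integral>x. f x \<partial>M) = 0 \<Longrightarrow> \<exists>C. \<forall>n. l2norm M ((T ^^ n) f) \<le> C * q ^ n"
    and q: "0 \<le> q" and K: "0 \<le> K"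
    and f: "f \<in> L2 M" "(\<integral>x. f x \<partial>M) = 0"
  shows "l2norm M (T f) \<le> q * l2norm M f"
proof -
  have core: "l2norm M (T g) \<le> q * l2norm M g" if g: "g \<in> D" "(\<integral>x. g x \<partial>M) = 0" for g
  proof -
    obtain C where C: "\<And>n. l2norm M ((T ^^ n) g) \<le> C * q ^ n" using decay[OF g] by auto
    have iter: "(T ^^ n) g \<in> L2 M" for n
      using g D L2 by (induction n) auto
    define a where "a n = l2norm M ((T ^^ n) g)" for n
    \<comment> \<open>Symmetry moves one factor \<open>T\<close> across the inner product: the
      squared norm of iterate \<open>n + 1\<close> is the inner product of iterates \<open>n\<close>
      and \<open>n + 2\<close>, to which Cauchy-Schwarz applies.\<close>
    have "(a (Suc n))\<^sup>2 \<le> a n * a (Suc (Suc n))" for n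
    proof -
      have "(a (Suc n))\<^sup>2 = (\<integral>x. T ((T ^^ n) g) x * (T ^^ Suc n) g x \<partial>M)"
        by (simp add: a_def l2norm_sq flip: power2_eq_square)
      also have "\<dots> = (\<integral>x. (T ^^ n) g x * T ((T ^^ Suc n) g) x \<partial>M)"
        by (rule symmetric[symmetric]) (rule iter)+
      also have "\<dots> \<le> a n * a (Suc (Suc n))"
        using Cauchy_Schwarz_L2[OF iter[of n] iter[of "Suc (Suc n)"]] by (simp add: a_def)
      finally show ?thesis .
    qed
    then have "a 1 \<le> q * a 0"
      using C q by (intro log_convex_geometric_bound[where C=C]) (auto simp: a_def)
    then show ?thesis by (simp add: a_def)
  qed
  show ?thesis
  proof (rule field_le_epsilon)
    fix e :: real assume e: "e > 0"
    \<comment> \<open>An approximation error below \<open>d\<close> costs at most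
      \<open>q * d\<close> through the norm of \<open>h\<close> and \<open>K * d\<close> through the
      remainder \<open>f - h\<close>.\<close>
    define d where "d = e / (q + K + 1)"
    have d: "d > 0" using e q K by (simp add: d_def)
    have qd: "(q + K) * d \<le> e" using e q K by (simp add: d_def field_simps)
    obtain g where g: "g \<in> D" "l2norm M (\<lambda>x. f x - g x) < d" using dense[OF f(1) d] by auto
    define h where "h x = g x - (\<integral>x. g x \<partial>M)" for x
    have gL: "g \<in> L2 M" using g D by auto
    have hD: "h \<in> D" using D_diff[OF g(1)] by (simp add: h_def[abs_def])
    then have hL: "h \<in> L2 M" using D by auto
    have h0: "(\<integral>x. h x \<partial>M) = 0" using integrable_L2[OF gL] by (simp add: h_def prob_space)
    have dist: "l2norm M (\<lambda>x. f x - h x) < d"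
    proof -
      \<comment> \<open>As \<open>f\<close> has mean zero, \<open>f - h\<close> is exactly the
        centred version of \<open>f - g\<close>.\<close>
      have "(\<integral>x. f x - g x \<partial>M) = - (\<integral>x. g x \<partial>M)"
        using integrable_L2[OF gL] integrable_L2[OF f(1)] f(2) by simp
      then have "l2norm M (\<lambda>x. f x - h x) \<le> l2norm M (\<lambda>x. f x - g x)"
        using l2norm_center_le[OF L2_diff[OF f(1) gL]] by (simp add: h_def algebra_simps)
      with g(2) show ?thesis by simp
    qed
    have fh: "(\<lambda>x. f x - h x) \<in> L2 M" by (rule L2_diff[OF f(1) hL])
    have "l2norm M (T f) = l2norm M (\<lambda>x. T h x + T (\<lambda>x. f x - h x) x)"
      using additive[OF hL fh] L2_D(1)[OF L2[OF f(1)]] L2_D(1)[OF L2[OF hL]] L2_D(1)[OF L2[OF fh]]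
      by (intro l2norm_cong_AE) auto
    also have "\<dots> \<le> l2norm M (T h) + l2norm M (T (\<lambda>x. f x - h x))"
      by (intro l2norm_triangle L2 hL fh)
    also have "\<dots> \<le> q * l2norm M h + K * l2norm M (\<lambda>x. f x - h x)"
      by (intro add_mono core hD h0 bounded fh)
    also have "\<dots> \<le> q * (l2norm M f + d) + K * d"
    proof (intro add_mono mult_left_mono)
      have "l2norm M (\<lambda>x. f x + (h x - f x)) \<le> l2norm M f + l2norm M (\<lambda>x. h x - f x)"
        by (intro l2norm_triangle f L2_diff hL)
      then show "l2norm M h \<le> l2norm M f + d"
        using dist l2norm_minus_commute[of M f h] by simp
    qed (use q K dist in auto)
    also have "\<dots> \<le> q * l2norm M f + e" using qd by (simp add: algebra_simps)
    finally show "l2norm M (T f) \<le> q * l2norm M f + e" .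
  qed
qed

section \<open>Density in the space of square-integrable functions\<close>

text \<open>The sets whose indicators are L1-limits of \<open>[0,1]\<close>-valued members of
  \<open>E\<close> form a sigma-algebra, so they exhaust \<open>sets M\<close>. Products in
  \<open>E\<close> handle intersections, hence \<open>G\<close> need not be stable under them.
  Indicators then give simple functions, and dominated convergence gives all of L2.\<close>

lemma (in finite_measure) L2_dense_of_generator:
  assumes const: "\<And>c. (\<lambda>_. c) \<in> E"
    and add: "\<And>f g. f \<in> E \<Longrightarrow> g \<in> E \<Longrightarrow> (\<lambda>x. f x + g x) \<in> E"
    and mult: "\<And>f g. f \<in> E \<Longrightarrow> g \<in> E \<Longrightarrow> (\<lambda>x. f x * g x) \<in> E"
    and E: "E \<subseteq> L2 M"
    and gen: "sets M = sigma_sets (space M) G"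
    and approx: "\<And>A e. A \<in> G \<Longrightarrow> 0 < e \<Longrightarrow> \<exists>g\<in>E. (\<forall>x\<in>space M. 0 \<le> g x \<and> g x \<le> 1) \<and>
      (\<integral>x. \<bar>indicator A x - g x\<bar> \<partial>M) < e"
    and f: "f \<in> L2 M" and e: "0 < e"
  shows "\<exists>g\<in>E. l2norm M (\<lambda>x. f x - g x) < e"
proof -
  \<comment> \<open>The restriction to values in \<open>[0,1]\<close> keeps products under control
    and later lets an L1 error bound an L2 error.\<close>
  define app where "app A \<longleftrightarrow> A \<in> sets M \<and> (\<forall>e>0. \<exists>g\<in>E. (\<forall>x\<in>space M. 0 \<le> g x \<and> g x \<le> 1) \<and>
      (\<integral>x. \<bar>indicator A x - g x\<bar> \<partial>M) < e)" for A
  have E_meas [measurable_dest]: "g \<in> E \<Longrightarrow> g \<in> borel_measurable M" for g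
    using E L2_D(1) by blast
  have int_abs: "integrable M (\<lambda>x. \<bar>indicator A x - g x\<bar>)" if "g \<in> E" "A \<in> sets M" for g A
    using that E integrable_L2[of g]
    by (intro integrable_abs Bochner_Integration.integrable_diff) (auto simp: less_top[symmetric])
  have app_compl: "app (space M - A)" if A: "app A" for A
    unfolding app_def
  proof (intro conjI allI impI)
    fix e :: real assume "e > 0"
    with A obtain g where g: "g \<in> E" "\<forall>x\<in>space M. 0 \<le> g x \<and> g x \<le> 1"
      "(\<integral>x. \<bar>indicator A x - g x\<bar> \<partial>M) < e"
      unfolding app_def by blast
    have "(\<lambda>x. 1 + (- 1) * g x) \<in> E" by (intro add mult const g)
    moreover have "(\<integral>x. \<bar>indicator (space M - A) x - (1 + (- 1) * g x)\<bar> \<partial>M)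
        = (\<integral>x. \<bar>indicator A x - g x\<bar> \<partial>M)"
      by (intro Bochner_Integration.integral_cong) (auto split: split_indicator)
    ultimately show "\<exists>g\<in>E. (\<forall>x\<in>space M. 0 \<le> g x \<and> g x \<le> 1) \<and>
      (\<integral>x. \<bar>indicator (space M - A) x - g x\<bar> \<partial>M) < e"
      using g by (intro bexI[where x = "\<lambda>x. 1 + (- 1) * g x"]) auto
  qed (use A in \<open>auto simp: app_def\<close>)
  have app_Int: "app (A \<inter> B)" if A: "app A" and B: "app B" for A B
    unfolding app_def
  proof (intro conjI allI impI)
    fix e :: real assume "e > 0"
    then have e2: "e / 2 > 0" by simp
    obtain g where g: "g \<in> E" "\<forall>x\<in>space M. 0 \<le> g x \<and> g x \<le> 1"
      "(\<integral>x. \<bar>indicator A x - g x\<bar> \<partial>M) < e / 2"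
      using A e2 unfolding app_def by blast
    obtain h where h: "h \<in> E" "\<forall>x\<in>space M. 0 \<le> h x \<and> h x \<le> 1"
      "(\<integral>x. \<bar>indicator B x - h x\<bar> \<partial>M) < e / 2"
      using B e2 unfolding app_def by blast
    have sets: "A \<in> sets M" "B \<in> sets M" using A B by (auto simp: app_def)
    have "(\<integral>x. \<bar>indicator (A \<inter> B) x - g x * h x\<bar> \<partial>M)
        \<le> (\<integral>x. \<bar>indicator A x - g x\<bar> + \<bar>indicator B x - h x\<bar> \<partial>M)"
    proof (rule integral_mono)
      fix x assume x: "x \<in> space M"
      \<comment> \<open>Replacing one factor at a time makes the errors of the two approximants add
        up.\<close>
      have "\<bar>s * t - u * v\<bar> \<le> \<bar>s - u\<bar> + \<bar>t - v\<bar>"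
        if "0 \<le> t" "t \<le> 1" "0 \<le> u" "u \<le> 1" for s t u v :: real
      proof -
        have "s * t - u * v = (s - u) * t + u * (t - v)" by (simp add: algebra_simps)
        then have "\<bar>s * t - u * v\<bar> \<le> \<bar>s - u\<bar> * t + u * \<bar>t - v\<bar>"
          using that abs_triangle_ineq[of "(s - u) * t" "u * (t - v)"] by (simp add: abs_mult)
        also have "\<dots> \<le> \<bar>s - u\<bar> * 1 + 1 * \<bar>t - v\<bar>"
          using that by (intro add_mono mult_left_mono mult_right_mono) auto
        finally show ?thesis by simp
      qed
      from this[of "indicator B x" "g x" "indicator A x" "h x"]
      show "\<bar>indicator (A \<inter> B) x - g x * h x\<bar> \<le> \<bar>indicator A x - g x\<bar> + \<bar>indicator B x - h x\<bar>"
        using g(2) h(2) x by (simp add: indicator_inter_arith)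
    qed (use g h sets in \<open>auto intro!: int_abs mult\<close>)
    also have "\<dots> = (\<integral>x. \<bar>indicator A x - g x\<bar> \<partial>M) + (\<integral>x. \<bar>indicator B x - h x\<bar> \<partial>M)"
      by (intro Bochner_Integration.integral_add int_abs g h sets)
    also have "\<dots> < e" using g h by simp
    finally have "(\<integral>x. \<bar>indicator (A \<inter> B) x - g x * h x\<bar> \<partial>M) < e" .
    then show "\<exists>g\<in>E. (\<forall>x\<in>space M. 0 \<le> g x \<and> g x \<le> 1) \<and>
      (\<integral>x. \<bar>indicator (A \<inter> B) x - g x\<bar> \<partial>M) < e"
      using g h by (intro bexI[where x = "\<lambda>x. g x * h x"] mult) (auto intro: mult_le_one)
  qed (use A B in \<open>auto simp: app_def\<close>)
  have app_empty: "app {}"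
    unfolding app_def using const[of 0] by (auto intro!: bexI[where x = "\<lambda>_. 0"])
  have app_Un: "app (A \<union> B)" if A: "app A" and B: "app B" for A B
  proof -
    have "A \<union> B = space M - ((space M - A) \<inter> (space M - B))"
      using A B sets.sets_into_space[of A M] sets.sets_into_space[of B M] unfolding app_def by blast
    then show ?thesis using app_compl[OF app_Int[OF app_compl[OF A] app_compl[OF B]]] by simp
  qed
  have app_UN: "app (\<Union>i. A i)" if A: "\<And>i::nat. app (A i)" for A
    unfolding app_def
  proof (intro conjI allI impI)
    have sets [measurable]: "A i \<in> sets M" for i using A by (auto simp: app_def)
    show "(\<Union>i. A i) \<in> sets M" by auto
    fix e :: real assume "e > 0"
    \<comment> \<open>Finite unions exhaust the countable one. Since \<open>M\<close> is finite,
      some \<open>B n\<close> misses only mass below \<open>e / 2\<close>; an approximant of that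
      \<open>B n\<close> serves for the whole union.\<close>
    define B where "B n = (\<Union>i<n. A i)" for n
    have B: "app (B n)" for n
      unfolding B_def by (induction n) (auto simp: lessThan_Suc app_empty intro!: app_Un A)
    have [measurable]: "B n \<in> sets M" for n using B by (auto simp: app_def)
    have "incseq B" unfolding B_def by (intro monoI UN_mono) auto
    then have "(\<lambda>n. measure M (B n)) \<longlonglongrightarrow> measure M (\<Union>n. B n)"
      by (intro finite_Lim_measure_incseq) auto
    moreover have UB: "(\<Union>n. B n) = (\<Union>i. A i)" unfolding B_def by auto
    ultimately have "eventually (\<lambda>n. dist (measure M (B n)) (measure M (\<Union>i. A i)) < e / 2) sequentially"
      using \<open>e > 0\<close> by (intro tendstoD) auto
    then obtain n where n: "\<bar>measure M (B n) - measure M (\<Union>i. A i)\<bar> < e / 2"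
      by (auto simp: eventually_sequentially dist_real_def)
    obtain g where g: "g \<in> E" "\<forall>x\<in>space M. 0 \<le> g x \<and> g x \<le> 1"
      "(\<integral>x. \<bar>indicator (B n) x - g x\<bar> \<partial>M) < e / 2"
      using B[of n] half_gt_zero[OF \<open>e > 0\<close>] unfolding app_def by blast
    have BA: "B n \<subseteq> (\<Union>i. A i)" unfolding B_def by auto
    have "(\<integral>x. \<bar>indicator (\<Union>i. A i) x - g x\<bar> \<partial>M)
      \<le> (\<integral>x. (indicator (\<Union>i. A i) x - indicator (B n) x) + \<bar>indicator (B n) x - g x\<bar> \<partial>M)"
    proof (rule integral_mono)
      show "integrable M (\<lambda>x. (indicator (\<Union>i. A i) x - indicator (B n) x) + \<bar>indicator (B n) x - g x\<bar>)"
        using g by (intro Bochner_Integration.integrable_add int_abs Bochner_Integration.integrable_diff)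
         (auto simp: less_top[symmetric])
    qed (use g BA in \<open>auto intro!: int_abs split: split_indicator\<close>)
    also have "\<dots> = (measure M (\<Union>i. A i) - measure M (B n)) + (\<integral>x. \<bar>indicator (B n) x - g x\<bar> \<partial>M)"
      using g by (subst Bochner_Integration.integral_add)
        (auto simp: less_top[symmetric] Int_absorb1 sets.sets_into_space intro!: int_abs)
    also have "\<dots> < e" using g(3) n by (simp only: abs_less_iff) linarith
    finally show "\<exists>g\<in>E. (\<forall>x\<in>space M. 0 \<le> g x \<and> g x \<le> 1) \<and>
      (\<integral>x. \<bar>indicator (\<Union>i. A i) x - g x\<bar> \<partial>M) < e"
      using g by blast
  qed
  have G: "G \<subseteq> sets M" using gen by auto
  have app_all: "app A" if "A \<in> sets M" for A
    using that unfolding gen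
  proof (induction rule: sigma_sets.induct)
    case (Basic A)
    then show ?case using approx G unfolding app_def by blast
  next
    case Empty
    then show ?case by (rule app_empty)
  next
    case (Compl A)
    then show ?case by (intro app_compl)
  next
    case (Union A)
    then show ?case by (intro app_UN)
  qed
  define cl where "cl f \<longleftrightarrow> f \<in> L2 M \<and> (\<forall>e>0. \<exists>g\<in>E. l2norm M (\<lambda>x. f x - g x) < e)" for f
  have cl_ind: "cl (\<lambda>x. c * indicator A x)" if A: "A \<in> sets M" for A c
    unfolding cl_def
  proof (intro conjI allI impI)
    have iL: "indicator A \<in> L2 M"
      using A by (intro L2_bounded[where B = 1]) (auto split: split_indicator)
    show "(\<lambda>x. c * indicator A x) \<in> L2 M"
      by (rule L2_scale[OF iL])
    fix e :: real assume e: "e > 0"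
    define d where "d = e / (\<bar>c\<bar> + 1)"
    have d: "d > 0" using e by (simp add: d_def)
    obtain g where g: "g \<in> E" "\<forall>x\<in>space M. 0 \<le> g x \<and> g x \<le> 1"
      "(\<integral>x. \<bar>indicator A x - g x\<bar> \<partial>M) < d\<^sup>2"
      using app_all[OF A] d unfolding app_def by (meson zero_less_power)
    \<comment> \<open>The error lies in \<open>[-1,1]\<close>, so its square is at most its absolute
      value. This is why the L1 approximation was requested to precision \<open>d\<close>
      squared.\<close>
    have "(l2norm M (\<lambda>x. indicator A x - g x))\<^sup>2 \<le> (\<integral>x. \<bar>indicator A x - g x\<bar> \<partial>M)"
      unfolding l2norm_sq
    proof (rule integral_mono)
      show "integrable M (\<lambda>x. (indicator A x - g x)\<^sup>2)"
        using L2_D(2)[OF L2_diff[OF iL]] g(1) E by blast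
      fix x assume "x \<in> space M"
      then have "\<bar>indicator A x - g x\<bar> \<le> 1" using g(2) by (auto split: split_indicator)
      then have "\<bar>indicator A x - g x\<bar> * \<bar>indicator A x - g x\<bar> \<le> 1 * \<bar>indicator A x - g x\<bar>"
        by (intro mult_right_mono) auto
      then show "(indicator A x - g x)\<^sup>2 \<le> \<bar>indicator A x - g x\<bar>"
        by (simp add: power2_eq_square flip: abs_mult)
    qed (use g A in \<open>auto intro: int_abs\<close>)
    also have "\<dots> < d\<^sup>2" using g by simp
    finally have lt: "l2norm M (\<lambda>x. indicator A x - g x) < d"
      using d by (simp add: power2_less_imp_less)
    have "l2norm M (\<lambda>x. c * indicator A x - c * g x) = \<bar>c\<bar> * l2norm M (\<lambda>x. indicator A x - g x)"
      by (simp add: l2norm_scale flip: right_diff_distrib)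
    also have "\<dots> \<le> \<bar>c\<bar> * d" using lt by (intro mult_left_mono) auto
    also have "\<dots> < e" using e by (simp add: d_def field_simps)
    finally show "\<exists>g\<in>E. l2norm M (\<lambda>x. c * indicator A x - g x) < e"
      using mult[OF const[of c] g(1)] by (intro bexI)
  qed
  have cl_add: "cl (\<lambda>x. f x + g x)" if f: "cl f" and g: "cl g" for f g
    unfolding cl_def
  proof (intro conjI allI impI)
    show "(\<lambda>x. f x + g x) \<in> L2 M" using f g by (auto simp: cl_def intro: L2_add)
    fix e :: real assume "e > 0"
    then have e2: "e / 2 > 0" by simp
    obtain f' where f': "f' \<in> E" "l2norm M (\<lambda>x. f x - f' x) < e / 2" using f e2 unfolding cl_def by blast
    obtain g' where g': "g' \<in> E" "l2norm M (\<lambda>x. g x - g' x) < e / 2" using g e2 unfolding cl_def by blast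
    have "l2norm M (\<lambda>x. (f x - f' x) + (g x - g' x)) \<le> l2norm M (\<lambda>x. f x - f' x) + l2norm M (\<lambda>x. g x - g' x)"
      using f g f' g' E by (intro l2norm_triangle L2_diff) (auto simp: cl_def)
    then have "l2norm M (\<lambda>x. (f x + g x) - (f' x + g' x)) < e"
      using f' g' by (simp add: algebra_simps)
    then show "\<exists>h\<in>E. l2norm M (\<lambda>x. f x + g x - h x) < e" using add[OF f'(1) g'(1)] by (intro bexI)
  qed
  have cl_simple: "cl s" if s: "simple_function M s" for s :: "'a \<Rightarrow> real"
  proof -
    have sum: "cl (\<lambda>x. \<Sum>y\<in>Y. y * indicator (s -` {y} \<inter> space M) x)" if "finite Y" for Y
      using that
    proof (induction Y rule: finite_induct)
      case empty
      show ?case using cl_ind[of "{}" 0] by simp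
    next
      case (insert y Y)
      have "cl (\<lambda>x. y * indicator (s -` {y} \<inter> space M) x
          + (\<Sum>y\<in>Y. y * indicator (s -` {y} \<inter> space M) x))"
        by (rule cl_add[OF cl_ind insert.IH]) (rule simple_functionD(2)[OF s])
      then show ?case by (simp only: sum.insert[OF insert.hyps])
    qed
    define s' where "s' x = (\<Sum>y\<in>s ` space M. y * indicator (s -` {y} \<inter> space M) x)" for x
    have cl': "cl s'"
      unfolding s'_def[abs_def] by (rule sum) (rule simple_functionD(1)[OF s])
    have eq: "s' x = s x" if "x \<in> space M" for x
      using simple_function_indicator_representation_banach[OF s that]
      unfolding real_scaleR_def s'_def by (subst mult.commute) (rule sym)
    show ?thesis unfolding cl_def
    proof (intro conjI allI impI)
      have "s' \<in> L2 M" using cl' by (simp add: cl_def)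
      then show "s \<in> L2 M"
        by (rule L2_dominated) (auto simp: eq intro: borel_measurable_simple_function[OF s])
      fix e :: real assume "e > 0"
      then obtain g where g: "g \<in> E" "l2norm M (\<lambda>x. s' x - g x) < e"
        using cl' unfolding cl_def by blast
      have "l2norm M (\<lambda>x. s' x - g x) = l2norm M (\<lambda>x. s x - g x)"
        unfolding l2norm_def
        by (intro arg_cong[where f = sqrt] Bochner_Integration.integral_cong) (auto simp: eq)
      with g show "\<exists>g\<in>E. l2norm M (\<lambda>x. s x - g x) < e" by auto
    qed
  qed
  note [measurable] = L2_D(1)[OF f]
  obtain F where F: "\<And>i. simple_function M (F i)" "\<And>x. x \<in> space M \<Longrightarrow> (\<lambda>i. F i x) \<longlonglongrightarrow> f x"
    "\<And>i x. x \<in> space M \<Longrightarrow> dist (F i x) 0 \<le> 2 * dist (f x) 0"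
    using borel_measurable_implies_sequence_metric[OF L2_D(1)[OF f], of 0] by metis
  note [measurable] = borel_measurable_simple_function[OF F(1)]
  have "(\<lambda>i. \<integral>x. (f x - F i x)\<^sup>2 \<partial>M) \<longlonglongrightarrow> (\<integral>x. 0 \<partial>M)"
  proof (rule integral_dominated_convergence)
    show "integrable M (\<lambda>x. 9 * (f x)\<^sup>2)" using L2_D(2)[OF f] by simp
    show "AE x in M. (\<lambda>i. (f x - F i x)\<^sup>2) \<longlonglongrightarrow> 0"
    proof (rule AE_I2)
      fix x assume "x \<in> space M"
      have "(\<lambda>i. (f x - F i x)\<^sup>2) \<longlonglongrightarrow> (f x - f x)\<^sup>2"
        using F(2)[OF \<open>x \<in> space M\<close>] by (intro tendsto_intros)
      then show "(\<lambda>i. (f x - F i x)\<^sup>2) \<longlonglongrightarrow> 0" by simp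
    qed
    show "AE x in M. norm ((f x - F i x)\<^sup>2) \<le> 9 * (f x)\<^sup>2" for i
    proof (rule AE_I2)
      fix x assume "x \<in> space M"
      \<comment> \<open>The approximants satisfy
        \<open>\<bar>F i x\<bar> \<le> 2 * \<bar>f x\<bar>\<close>; hence the factor 3 here and the
        dominating function \<open>9 * (f x)\<^sup>2\<close>.\<close>
      then have "\<bar>f x - F i x\<bar> \<le> 3 * \<bar>f x\<bar>" using F(3)[of x i] by simp
      then have "\<bar>f x - F i x\<bar>\<^sup>2 \<le> (3 * \<bar>f x\<bar>)\<^sup>2" by (intro power_mono) auto
      then show "norm ((f x - F i x)\<^sup>2) \<le> 9 * (f x)\<^sup>2" by (simp add: power_mult_distrib)
    qed
  qed measurable
  then have "(\<lambda>i. sqrt (\<integral>x. (f x - F i x)\<^sup>2 \<partial>M)) \<longlonglongrightarrow> sqrt 0"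
    by (intro tendsto_real_sqrt) simp
  then have "eventually (\<lambda>i. dist (sqrt (\<integral>x. (f x - F i x)\<^sup>2 \<partial>M)) (sqrt 0) < e / 2) sequentially"
    using e by (intro tendstoD) auto
  then obtain i where i: "l2norm M (\<lambda>x. f x - F i x) < e / 2"
    by (auto simp: eventually_sequentially l2norm_def dist_real_def)
  obtain g where g: "g \<in> E" "l2norm M (\<lambda>x. F i x - g x) < e / 2"
    using cl_simple[OF F(1), of i] half_gt_zero[OF e] unfolding cl_def by blast
  have "l2norm M (\<lambda>x. (f x - F i x) + (F i x - g x)) \<le> l2norm M (\<lambda>x. f x - F i x) + l2norm M (\<lambda>x. F i x - g x)"
    using cl_simple[OF F(1), of i] g f E by (intro l2norm_triangle L2_diff) (auto simp: cl_def)
  then show ?thesis using g i by (intro bexI[of _ g]) auto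
qed

section \<open>Reversible resampling kernels\<close>

text \<open>\<open>r x\<close> is the density of the new value and \<open>t x u\<close> the state
  after it is inserted. Reversibility says that the pair of old and new state is exchangeable. It is
  stated for nonnegative integrands, so it presupposes no integrability.\<close>

locale reversible_resampling = prob_space M for M :: "'a measure" +
  fixes r :: "'a \<Rightarrow> real \<Rightarrow> real" and t :: "'a \<Rightarrow> real \<Rightarrow> 'a"
  assumes r_measurable [measurable]: "(\<lambda>(x, u). r x u) \<in> borel_measurable (M \<Otimes>\<^sub>M lborel)"
    and t_measurable [measurable]: "(\<lambda>(x, u). t x u) \<in> measurable (M \<Otimes>\<^sub>M lborel) M"
    and r_nonneg: "\<And>x u. 0 \<le> r x u"
    and r_integrable: "\<And>x. x \<in> space M \<Longrightarrow> integrable lborel (r x)"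
    and r_integral: "\<And>x. x \<in> space M \<Longrightarrow> (\<integral>u. r x u \<partial>lborel) = 1"
    and reversible: "\<And>F. F \<in> borel_measurable (M \<Otimes>\<^sub>M M) \<Longrightarrow>
      (\<integral>\<^sup>+x. \<integral>\<^sup>+u. F (x, t x u) * ennreal (r x u) \<partial>lborel \<partial>M)
      = (\<integral>\<^sup>+x. \<integral>\<^sup>+u. F (t x u, x) * ennreal (r x u) \<partial>lborel \<partial>M)"
begin

sublocale P: pair_sigma_finite M lborel ..

lemma nn_integral_r: "x \<in> space M \<Longrightarrow> (\<integral>\<^sup>+u. ennreal (r x u) \<partial>lborel) = 1"
  by (subst nn_integral_eq_integral) (auto simp: r_integral r_integrable r_nonneg)

lemma measurable_r_section [measurable]: "x \<in> space M \<Longrightarrow> r x \<in> borel_measurable lborel"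
  using r_integrable by blast

lemma invariant:
  assumes [measurable]: "h \<in> borel_measurable M"
  shows "(\<integral>\<^sup>+x. \<integral>\<^sup>+u. h (t x u) * ennreal (r x u) \<partial>lborel \<partial>M) = (\<integral>\<^sup>+x. h x \<partial>M)"
proof -
  have "(\<integral>\<^sup>+x. \<integral>\<^sup>+u. h (t x u) * ennreal (r x u) \<partial>lborel \<partial>M)
      = (\<integral>\<^sup>+x. \<integral>\<^sup>+u. h x * ennreal (r x u) \<partial>lborel \<partial>M)"
    using reversible[of "\<lambda>(x, y). h y"] by simp
  also have "\<dots> = (\<integral>\<^sup>+x. h x \<partial>M)"
    by (intro nn_integral_cong) (simp add: nn_integral_cmult nn_integral_r)
  finally show ?thesis .
qed

definition Q :: "('a \<Rightarrow> real) \<Rightarrow> 'a \<Rightarrow> real" where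
  "Q f x = (\<integral>u. f (t x u) * r x u \<partial>lborel)"

lemma measurable_Q [measurable]:
  assumes [measurable]: "f \<in> borel_measurable M"
  shows "Q f \<in> borel_measurable M"
  unfolding Q_def by measurable

lemma integrable_square_fst:
  assumes f: "f \<in> L2 M"
  shows "integrable (M \<Otimes>\<^sub>M lborel) (\<lambda>(x, u). (f x)\<^sup>2 * r x u)"
proof (rule integrableI_bounded)
  note [measurable] = L2_D(1)[OF f]
  have "(\<integral>\<^sup>+z. ennreal (norm (case z of (x, u) \<Rightarrow> (f x)\<^sup>2 * r x u)) \<partial>(M \<Otimes>\<^sub>M lborel))
      = (\<integral>\<^sup>+x. \<integral>\<^sup>+u. ennreal ((f x)\<^sup>2) * ennreal (r x u) \<partial>lborel \<partial>M)"
    by (subst lborel.nn_integral_fst[symmetric]) (auto simp: ennreal_mult r_nonneg abs_mult)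
  also have "\<dots> = (\<integral>\<^sup>+x. ennreal ((f x)\<^sup>2) \<partial>M)"
    by (intro nn_integral_cong) (simp add: nn_integral_cmult nn_integral_r)
  also have "\<dots> < \<infinity>"
    using L2_D(2)[OF f] by (subst nn_integral_eq_integral) auto
  finally show "(\<integral>\<^sup>+z. ennreal (norm (case z of (x, u) \<Rightarrow> (f x)\<^sup>2 * r x u)) \<partial>(M \<Otimes>\<^sub>M lborel)) < \<infinity>" .
qed (use L2_D(1)[OF f] in measurable)

lemma
  assumes f: "f \<in> L2 M"
  shows integrable_square_snd: "integrable (M \<Otimes>\<^sub>M lborel) (\<lambda>(x, u). (f (t x u))\<^sup>2 * r x u)"
    and integral_square_snd: "(\<integral>(x, u). (f (t x u))\<^sup>2 * r x u \<partial>(M \<Otimes>\<^sub>M lborel)) = (\<integral>x. (f x)\<^sup>2 \<partial>M)"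
proof -
  note [measurable] = L2_D(1)[OF f]
  have "(\<integral>\<^sup>+z. ennreal (case z of (x, u) \<Rightarrow> (f (t x u))\<^sup>2 * r x u) \<partial>(M \<Otimes>\<^sub>M lborel))
      = (\<integral>\<^sup>+x. \<integral>\<^sup>+u. ennreal ((f (t x u))\<^sup>2) * ennreal (r x u) \<partial>lborel \<partial>M)"
    by (subst lborel.nn_integral_fst[symmetric]) (auto simp: ennreal_mult r_nonneg abs_mult)
  also have "\<dots> = (\<integral>\<^sup>+x. ennreal ((f x)\<^sup>2) \<partial>M)"
    by (rule invariant) measurable
  also have "\<dots> = ennreal (\<integral>x. (f x)\<^sup>2 \<partial>M)"
    using L2_D(2)[OF f] by (subst nn_integral_eq_integral) auto
  finally have *: "(\<integral>\<^sup>+z. ennreal (case z of (x, u) \<Rightarrow> (f (t x u))\<^sup>2 * r x u) \<partial>(M \<Otimes>\<^sub>M lborel))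
      = ennreal (\<integral>x. (f x)\<^sup>2 \<partial>M)" .
  have "has_bochner_integral (M \<Otimes>\<^sub>M lborel) (\<lambda>(x, u). (f (t x u))\<^sup>2 * r x u) (\<integral>x. (f x)\<^sup>2 \<partial>M)"
    by (rule has_bochner_integral_nn_integral[OF _ _ _ *]) (auto simp: r_nonneg)
  then show "integrable (M \<Otimes>\<^sub>M lborel) (\<lambda>(x, u). (f (t x u))\<^sup>2 * r x u)"
    "(\<integral>(x, u). (f (t x u))\<^sup>2 * r x u \<partial>(M \<Otimes>\<^sub>M lborel)) = (\<integral>x. (f x)\<^sup>2 \<partial>M)"
    by (auto simp: has_bochner_integral_iff)
qed

text \<open>Old and new state both have law \<open>M\<close>, so the squares of \<open>g x\<close>
  and of \<open>f (t x u)\<close> are both integrable against the kernel, and their sum dominates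
  the product.\<close>

lemma integrable_cross:
  assumes f: "f \<in> L2 M" and g: "g \<in> L2 M"
  shows "integrable (M \<Otimes>\<^sub>M lborel) (\<lambda>(x, u). g x * f (t x u) * r x u)"
proof (rule Bochner_Integration.integrable_bound)
  note [measurable] = L2_D(1)[OF f] L2_D(1)[OF g]
  show "integrable (M \<Otimes>\<^sub>M lborel) (\<lambda>z. (\<lambda>(x, u). (g x)\<^sup>2 * r x u) z + (\<lambda>(x, u). (f (t x u))\<^sup>2 * r x u) z)"
    by (intro Bochner_Integration.integrable_add integrable_square_fst integrable_square_snd f g)
  show "(\<lambda>(x, u). g x * f (t x u) * r x u) \<in> borel_measurable (M \<Otimes>\<^sub>M lborel)" by measurable
  have "\<bar>a * b * c\<bar> \<le> \<bar>a\<^sup>2 * c + b\<^sup>2 * c\<bar>" if "0 \<le> c" for a b c :: real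
  proof -
    have "2 * (\<bar>a\<bar> * \<bar>b\<bar>) \<le> a\<^sup>2 + b\<^sup>2"
      using sum_squares_bound[of "\<bar>a\<bar>" "\<bar>b\<bar>"] by simp
    moreover have "0 \<le> \<bar>a\<bar> * \<bar>b\<bar>" by simp
    ultimately have "\<bar>a\<bar> * \<bar>b\<bar> \<le> a\<^sup>2 + b\<^sup>2" by linarith
    then have "\<bar>a\<bar> * \<bar>b\<bar> * c \<le> (a\<^sup>2 + b\<^sup>2) * c" using that by (rule mult_right_mono)
    then show ?thesis using that by (simp add: abs_mult distrib_right)
  qed
  then show "AE z in M \<Otimes>\<^sub>M lborel. norm ((\<lambda>(x, u). g x * f (t x u) * r x u) z)
      \<le> norm ((\<lambda>(x, u). (g x)\<^sup>2 * r x u) z + (\<lambda>(x, u). (f (t x u))\<^sup>2 * r x u) z)"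
    by (auto simp: r_nonneg)
qed

lemma AE_integrable_section:
  assumes f: "f \<in> L2 M"
  shows "AE x in M. integrable lborel (\<lambda>u. f (t x u) * r x u)"
  using P.AE_integrable_fst'[OF integrable_cross[OF f L2_const[of 1]]] by simp

text \<open>The Bochner integral takes the value 0 on sections that are not integrable, where
  additivity may fail. Fubini makes such sections negligible, but no more than that.\<close>

lemma Q_add:
  assumes f: "f \<in> L2 M" and g: "g \<in> L2 M"
  shows "AE x in M. Q (\<lambda>x. f x + g x) x = Q f x + Q g x"
  using AE_integrable_section[OF f] AE_integrable_section[OF g]
  by eventually_elim (simp add: Q_def distrib_right)

text \<open>Jensen's inequality for the square: the variance of \<open>f (t x u)\<close> under the
  probability density \<open>r x\<close> is nonnegative.\<close>

lemma Q_square_le: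
  assumes f: "f \<in> L2 M"
  shows "AE x in M. (Q f x)\<^sup>2 \<le> (\<integral>u. (f (t x u))\<^sup>2 * r x u \<partial>lborel)"
proof -
  have "AE x in M. integrable lborel (\<lambda>u. (f (t x u))\<^sup>2 * r x u)"
    using P.AE_integrable_fst'[OF integrable_square_snd[OF f]] by simp
  then show ?thesis using AE_integrable_section[OF f] AE_space
  proof eventually_elim
    case (elim x)
    define m where "m = Q f x"
    have "0 \<le> (\<integral>u. (f (t x u) - m)\<^sup>2 * r x u \<partial>lborel)" by (simp add: r_nonneg)
    also have "\<dots> = (\<integral>u. (f (t x u))\<^sup>2 * r x u - 2 * m * (f (t x u) * r x u) + m\<^sup>2 * r x u \<partial>lborel)"
      by (intro Bochner_Integration.integral_cong) (auto simp: power2_eq_square algebra_simps)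
    also have "\<dots> = (\<integral>u. (f (t x u))\<^sup>2 * r x u \<partial>lborel) - 2 * m * m + m\<^sup>2 * 1"
      using elim r_integrable[of x] by (simp add: r_integral m_def Q_def)
    finally show ?case by (simp add: m_def power2_eq_square)
  qed
qed

lemma Q_L2:
  assumes f: "f \<in> L2 M"
  shows "Q f \<in> L2 M"
proof -
  note [measurable] = L2_D(1)[OF f]
  have "integrable M (\<lambda>x. (Q f x)\<^sup>2)"
  proof (rule Bochner_Integration.integrable_bound)
    show "integrable M (\<lambda>x. \<integral>u. (f (t x u))\<^sup>2 * r x u \<partial>lborel)"
      using P.integrable_fst'[OF integrable_square_snd[OF f]] by simp
    show "AE x in M. norm ((Q f x)\<^sup>2) \<le> norm (\<integral>u. (f (t x u))\<^sup>2 * r x u \<partial>lborel)"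
      using Q_square_le[OF f] by eventually_elim simp
  qed measurable
  then show ?thesis by (simp add: L2_def)
qed

lemma l2norm_Q_le:
  assumes f: "f \<in> L2 M"
  shows "l2norm M (Q f) \<le> l2norm M f"
proof -
  have int: "integrable M (\<lambda>x. \<integral>u. (f (t x u))\<^sup>2 * r x u \<partial>lborel)"
    using P.integrable_fst'[OF integrable_square_snd[OF f]] by simp
  have "(\<integral>x. (Q f x)\<^sup>2 \<partial>M) \<le> (\<integral>x. \<integral>u. (f (t x u))\<^sup>2 * r x u \<partial>lborel \<partial>M)"
    by (rule integral_mono_AE[OF L2_D(2)[OF Q_L2[OF f]] int Q_square_le[OF f]])
  also have "\<dots> = (\<integral>x. (f x)\<^sup>2 \<partial>M)"
    using P.integral_fst'[OF integrable_square_snd[OF f]] integral_square_snd[OF f] by simp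
  finally show ?thesis by (simp add: l2norm_def)
qed

lemma integral_Q:
  assumes f: "f \<in> L2 M" and g: "g \<in> L2 M"
  shows "(\<integral>x. g x * Q f x \<partial>M) = (\<integral>(x, u). g x * f (t x u) * r x u \<partial>(M \<Otimes>\<^sub>M lborel))"
  using P.integral_fst'[OF integrable_cross[OF f g]] by (simp add: Q_def mult.assoc)

text \<open>Exchangeability swaps the roles of \<open>f\<close> and \<open>g\<close> in the joint
  integral. As it is available for nonnegative integrands only, it is applied to the positive and
  the negative part of the product separately.\<close>

lemma Q_symmetric:
  assumes f: "f \<in> L2 M" and g: "g \<in> L2 M"
  shows "(\<integral>x. g x * Q f x \<partial>M) = (\<integral>x. Q g x * f x \<partial>M)"
proof -
  note [measurable] = L2_D(1)[OF f] L2_D(1)[OF g]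
  have int: "(\<integral>x. g x * Q f x \<partial>M)
      = enn2real (\<integral>\<^sup>+x. \<integral>\<^sup>+u. ennreal (g x * f (t x u)) * ennreal (r x u) \<partial>lborel \<partial>M)
        - enn2real (\<integral>\<^sup>+x. \<integral>\<^sup>+u. ennreal (- (g x * f (t x u))) * ennreal (r x u) \<partial>lborel \<partial>M)"
    if f: "f \<in> L2 M" and g: "g \<in> L2 M" for f g
  proof -
    note [measurable] = L2_D(1)[OF f] L2_D(1)[OF g]
    have split: "ennreal (a * r x u) = ennreal a * ennreal (r x u)"
      "ennreal (- (a * r x u)) = ennreal (- a) * ennreal (r x u)" for a x u
      using ennreal_mult''[OF r_nonneg, of a] ennreal_mult''[OF r_nonneg, of "- a"] by auto
    show ?thesis
      unfolding integral_Q[OF f g] real_lebesgue_integral_def[OF integrable_cross[OF f g]]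
      by (subst (1 2) lborel.nn_integral_fst[symmetric]) (auto simp: split)
  qed
  have "(\<integral>x. g x * Q f x \<partial>M) = (\<integral>x. f x * Q g x \<partial>M)"
    unfolding int[OF f g] int[OF g f]
    using reversible[of "\<lambda>(x, y). ennreal (g x * f y)"] reversible[of "\<lambda>(x, y). ennreal (- (g x * f y))"]
    by (simp add: mult.commute)
  then show ?thesis by (simp add: mult.commute)
qed

lemma Q_const: "x \<in> space M \<Longrightarrow> Q (\<lambda>_. c) x = c"
  using r_integral[of x] r_integrable[of x] by (simp add: Q_def)

text \<open>Symmetry tested against the constant 1, which \<open>Q\<close> fixes.\<close>

lemma integral_Q_eq:
  assumes f: "f \<in> L2 M"
  shows "(\<integral>x. Q f x \<partial>M) = (\<integral>x. f x \<partial>M)"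
proof -
  have "(\<integral>x. Q f x \<partial>M) = (\<integral>x. Q (\<lambda>_. 1) x * f x \<partial>M)"
    using Q_symmetric[OF f L2_const[of 1]] by simp
  also have "\<dots> = (\<integral>x. f x \<partial>M)"
    by (intro Bochner_Integration.integral_cong) (auto simp: Q_const)
  finally show ?thesis .
qed

end

section \<open>Convex potentials and single-site densities\<close>

text \<open>\<open>q\<close> and \<open>r\<close> lie between \<open>p\<close> and \<open>s\<close>
  with mirrored barycentric weights, so the two convexity inequalities add up to the claim. It
  serves as the increasing-differences property behind the monotone likelihood ratio of the
  single-site densities.\<close>

lemma convex_on_exchange:
  fixes f :: "real \<Rightarrow> real"
  assumes f: "convex_on UNIV f" and "p \<le> q" "p \<le> r" "q + r = p + s"
  shows "f q + f r \<le> f p + f s"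
proof (cases "p = s")
  case True
  then show ?thesis using assms by (smt (verit))
next
  case False
  then have ps: "p < s" using assms by linarith
  define t where "t = (q - p) / (s - p)"
  have t: "0 \<le> t" "t \<le> 1" using assms ps by (auto simp: t_def field_simps)
  have tq: "t * (s - p) = q - p" using ps by (simp add: t_def)
  have q: "q = (1 - t) * p + t * s" using tq by (simp add: algebra_simps)
  have r: "r = (1 - (1 - t)) * p + (1 - t) * s" using tq assms(4) by (simp add: algebra_simps)
  have "f q \<le> (1 - t) * f p + t * f s"
    using convex_onD[OF f t, of p s] q by simp
  moreover have "f r \<le> (1 - (1 - t)) * f p + (1 - t) * f s"
    using convex_onD[OF f, of "1 - t" p s] t r by simp
  ultimately show ?thesis by (simp add: algebra_simps)
qed

section \<open>Growth of non-affine convex potentials\<close>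

lemma integrable_exp_neg_abs:
  fixes c :: real assumes c: "c > 0"
  shows "integrable lborel (\<lambda>t. exp (- c * \<bar>t\<bar>))"
proof -
  define f where "f t = indicator {0<..} t * exp (- (t * c))" for t :: real
  have f: "integrable lborel f"
    using integrable_I0i_exp_mscale[OF c] by (simp add: set_integrable_def f_def[abs_def])
  then have "integrable lborel (\<lambda>t. f (- t))"
    using lborel_integrable_real_affine[OF f, of "- 1" 0] by simp
  with f have "integrable lborel (\<lambda>t. f t + f (- t))" by simp
  moreover have "AE t in lborel. f t + f (- t) = exp (- c * \<bar>t\<bar>)"
    using AE_lborel_singleton[of "0::real"]
    by eventually_elim (auto simp: f_def mult.commute split: split_indicator)
  ultimately show ?thesis
    by (subst integrable_cong_AE[where g = "\<lambda>t. f t + f (- t)"]) (auto simp: f_def[abs_def])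
qed

text \<open>Chord slopes from 0 are nondecreasing and, for a non-affine \<open>V\<close>, not all
  equal; so \<open>V\<close> grows linearly on both sides relative to a suitable tilt
  \<open>a * t\<close>. The tilt does no harm later: summed over the increments of a path it depends
  only on the endpoints.\<close>

lemma potentials_lower_bound:
  assumes V: "V \<in> potentials"
  obtains a d C where "d > 0" "\<And>t. V t \<ge> a * t + d * \<bar>t\<bar> - C"
proof -
  have cv: "convex_on UNIV V" using V by (simp add: potentials_def)
  define p where "p x = (V x - V 0) / x" for x
  have p1: "(V z - V 0) / (z - 0) = p z" and p2: "(V 0 - V z) / (0 - z) = p z" for z
    using minus_divide_divide[of "V z - V 0" z] by (simp_all add: p_def)
  have mono: "p x \<le> p y" if xy: "x < y" "x \<noteq> 0" "y \<noteq> 0" for x y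
  proof -
    consider "0 < x" | "y < 0" | "x < 0" "0 < y" using xy by linarith
    then show ?thesis
    proof cases
      case 1
      then show ?thesis using convex_on_slope_le(1)[OF cv, of 0 y x] xy unfolding p2 by simp
    next
      case 2
      then show ?thesis using convex_on_slope_le(2)[OF cv, of x 0 y] xy unfolding p1 by simp
    next
      case 3
      then have "p x \<le> (V x - V y) / (x - y)"
        using convex_on_slope_le(1)[OF cv, of x y 0] unfolding p1 by simp
      also have "\<dots> \<le> p y"
        using convex_on_slope_le(2)[OF cv, of x y 0] 3 unfolding p2 by simp
      finally show ?thesis .
    qed
  qed
  \<comment> \<open>Otherwise the slopes on both sides coincide, \<open>V\<close> is affine, and its
    two asymptotic slopes both equal \<open>p 1\<close>.\<close>
  have "\<exists>x y. x < 0 \<and> 0 < y \<and> p x < p y"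
  proof (rule ccontr)
    assume "\<not> ?thesis"
    then have le: "p y \<le> p x" if "x < 0" "0 < y" for x y using that by (meson not_le)
    have const: "p x = p 1" if "x \<noteq> 0" for x
    proof -
      have 1: "p z = p w" if "z < 0" "0 < w" for z w
        using le[of z w] mono[of z w] that by simp
      show ?thesis using 1[of x 1] 1[of "-1" x] 1[of "-1" 1] that by (cases "x < 0") auto
    qed
    \<comment> \<open>Formulated for a general filter so that one argument covers both
      \<open>at_top\<close> and \<open>at_bot\<close>.\<close>
    have lim: "Lim F (\<lambda>x. ereal (V x / x)) = ereal (p 1)"
      if F: "F \<noteq> bot" "filterlim (\<lambda>x::real. x) at_infinity F" for F
    proof (rule tendsto_Lim[OF F(1)])
      have "((\<lambda>x. p 1 + V 0 / x) \<longlongrightarrow> p 1 + 0) F"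
        by (intro tendsto_intros tendsto_divide_0[OF tendsto_const F(2)])
      moreover have "eventually (\<lambda>x. p 1 + V 0 / x = V x / x) F"
      proof -
        have "eventually (\<lambda>x::real. x \<noteq> 0) at_infinity"
          by (auto simp: eventually_at_infinity intro!: exI[of _ 1])
        then have "eventually (\<lambda>x. x \<noteq> 0) F" using F(2) by (auto simp: filterlim_iff)
        then show ?thesis
        proof eventually_elim
          case (elim x)
          then show ?case using const[of x] by (simp add: p_def field_simps)
        qed
      qed
      ultimately have "((\<lambda>x. V x / x) \<longlongrightarrow> p 1) F"
        by (simp add: filterlim_cong[OF refl refl])
      then show "((\<lambda>x. ereal (V x / x)) \<longlongrightarrow> ereal (p 1)) F" by simp
    qed
    have "slope_at_top V = slope_at_bot V"
      unfolding slope_at_top_def slope_at_bot_def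
      by (simp add: lim filterlim_at_top_imp_at_infinity filterlim_at_bot_imp_at_infinity filterlim_ident)
    then show False using V by (simp add: potentials_def)
  qed
  then obtain x y where xy: "x < 0" "0 < y" "p x < p y" by blast
  \<comment> \<open>Chosen so that \<open>p x = a - d\<close> and \<open>p y = a + d\<close>: the
    outer chord slopes deviate from \<open>a\<close> by at least \<open>d\<close> in the favourable
    direction.\<close>
  define a d where "a = (p x + p y) / 2" and "d = (p y - p x) / 2"
  have d: "d > 0" using xy by (simp add: d_def)
  \<comment> \<open>On the strip between \<open>x\<close> and \<open>y\<close> only the wrong one of
    the two slope bounds is available. It loses \<open>2 * d * \<bar>t\<bar>\<close>, which is at
    most \<open>2 * d * (y - x)\<close>.\<close>
  define C where "C = \<bar>V 0\<bar> + 2 * d * (y - x)"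
  have pV: "V t = V 0 + p t * t" for t by (cases "t = 0") (auto simp: p_def)
  have "V t \<ge> a * t + d * \<bar>t\<bar> - C" for t
  proof -
    consider "t = 0" | "0 < t" "t < y" | "t \<ge> y" | "t \<le> x" | "x < t" "t < 0" by linarith
    then show ?thesis
    proof cases
      case 1
      have "2 * d * (y - x) \<ge> 0" using d xy by simp
      then show ?thesis using 1 by (simp add: C_def)
    next
      case 2
      have "p t * t \<ge> p x * t" using mono[of x t] 2 xy by (intro mult_right_mono) auto
      also have "p x * t = a * t + d * t - 2 * d * t"
        by (simp add: a_def d_def field_simps)
      finally have "V t \<ge> V 0 + a * t + d * t - 2 * d * t" using pV[of t] by simp
      moreover have "2 * d * t \<le> 2 * d * (y - x)" using 2 d xy by (intro mult_left_mono) auto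
      ultimately show ?thesis using 2 by (simp add: C_def)
    next
      case 3
      have "p t * t \<ge> p y * t" using mono[of y t] 3 xy by (cases "t = y") (auto intro!: mult_right_mono)
      also have "p y * t = a * t + d * t" by (simp add: a_def d_def field_simps)
      finally have "V t \<ge> V 0 + a * t + d * t" using pV[of t] by simp
      moreover have "2 * d * (y - x) \<ge> 0" using d xy by simp
      ultimately show ?thesis using 3 xy by (simp add: C_def)
    next
      case 4
      have "p t * t \<ge> p x * t" using mono[of t x] 4 xy by (cases "t = x") (auto intro!: mult_right_mono_neg)
      also have "p x * t = a * t - d * t" by (simp add: a_def d_def field_simps)
      finally have "V t \<ge> V 0 + a * t - d * t" using pV[of t] by simp
      moreover have "2 * d * (y - x) \<ge> 0" using d xy by simp
      ultimately show ?thesis using 4 xy by (simp add: C_def)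
    next
      case 5
      have "p t * t \<ge> p y * t" using mono[of t y] 5 xy by (intro mult_right_mono_neg) auto
      also have "p y * t = a * t - d * t + 2 * d * t"
        by (simp add: a_def d_def field_simps)
      finally have "V t \<ge> V 0 + a * t - d * t + 2 * d * t" using pV[of t] by simp
      moreover have "2 * d * (- t) \<le> 2 * d * (y - x)" using 5 d xy by (intro mult_left_mono) auto
      ultimately show ?thesis using 5 by (simp add: C_def)
    qed
  qed
  with d show ?thesis by (rule that)
qed

section \<open>The single-site densities and their dependence on the neighbours\<close>

locale potential =
  fixes V :: "real \<Rightarrow> real"
  assumes V: "V \<in> potentials"
begin

lemma convex_V: "convex_on UNIV V"
  using V by (simp add: potentials_def)

lemma measurable_V [measurable]: "V \<in> borel_measurable borel"
  using convex_on_continuous[OF open_UNIV convex_V] by (rule borel_measurable_continuous_onI)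

definition weight :: "real \<Rightarrow> real \<Rightarrow> real \<Rightarrow> real" where
  "weight b c u = exp (- V (u - b) - V (c - u))"

lemma measurable_weight [measurable]:
  assumes [measurable]: "f \<in> borel_measurable M" "g \<in> borel_measurable M" "h \<in> borel_measurable M"
  shows "(\<lambda>x. weight (f x) (g x) (h x)) \<in> borel_measurable M"
  unfolding weight_def by measurable

lemma weight_pos [simp]: "weight b c u > 0"
  by (simp add: weight_def)

lemma weight_nonneg [simp]: "weight b c u \<ge> 0"
  by (simp add: less_imp_le)

text \<open>The tilts of the two factors add up to \<open>a * (c - b)\<close>, which does not depend
  on \<open>u\<close>. Of the two absolute values one suffices for decay, so the other is
  dropped.\<close>

lemma weight_exp_bound:
  obtains K d where "d > 0" "\<And>u. weight b c u \<le> K * exp (- d * \<bar>u\<bar>)"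
proof -
  obtain a d C where d: "d > 0" and low: "\<And>t. V t \<ge> a * t + d * \<bar>t\<bar> - C"
    using potentials_lower_bound[OF V] by metis
  have "weight b c u \<le> exp (2 * C - a * (c - b) + d * \<bar>b\<bar>) * exp (- d * \<bar>u\<bar>)" for u
  proof -
    have "- V (u - b) - V (c - u) \<le> - (a * (u - b) + d * \<bar>u - b\<bar> - C) - (a * (c - u) + d * \<bar>c - u\<bar> - C)"
      using low[of "u - b"] low[of "c - u"] by linarith
    also have "\<dots> = 2 * C - a * (c - b) - d * \<bar>u - b\<bar> - d * \<bar>c - u\<bar>"
      by (simp add: algebra_simps)
    also have "\<dots> \<le> 2 * C - a * (c - b) - d * (\<bar>u\<bar> - \<bar>b\<bar>)"
    proof -
      have "d * (\<bar>u\<bar> - \<bar>b\<bar>) \<le> d * \<bar>u - b\<bar>" using d by (intro mult_left_mono) auto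
      moreover have "0 \<le> d * \<bar>c - u\<bar>" using d by simp
      ultimately show ?thesis by linarith
    qed
    finally show ?thesis by (simp add: weight_def algebra_simps flip: exp_add)
  qed
  with d show ?thesis by (rule that)
qed

text \<open>Half of the exponential decay absorbs the linear factor, through
  \<open>\<bar>u\<bar> \<le> 2 / d * exp (d / 2 * \<bar>u\<bar>)\<close>; the other half is
  integrable.\<close>

lemma integrable_weight_linear: "integrable lborel (\<lambda>u. (A + B * \<bar>u\<bar>) * weight b c u)"
proof -
  obtain K d where d: "d > 0" and w: "\<And>u. weight b c u \<le> K * exp (- d * \<bar>u\<bar>)"
    using weight_exp_bound[of b c] by metis
  have K: "K \<ge> 0" using order_trans[OF weight_nonneg w[of 0]] by simp
  show ?thesis
  proof (rule Bochner_Integration.integrable_bound)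
    show "integrable lborel (\<lambda>u. (\<bar>A\<bar> + \<bar>B\<bar> * 2 / d) * K * exp (- (d / 2) * \<bar>u\<bar>))"
      using d by (intro integrable_mult_right integrable_exp_neg_abs) simp
    have "\<bar>(A + B * \<bar>u\<bar>) * weight b c u\<bar> \<le> (\<bar>A\<bar> + \<bar>B\<bar> * 2 / d) * K * exp (- (d / 2) * \<bar>u\<bar>)" for u
    proof -
      have 1: "1 \<le> exp (d / 2 * \<bar>u\<bar>)" using d by simp
      have "d / 2 * \<bar>u\<bar> \<le> exp (d / 2 * \<bar>u\<bar>)" using exp_ge_add_one_self[of "d / 2 * \<bar>u\<bar>"] by linarith
      then have 2: "\<bar>u\<bar> \<le> 2 / d * exp (d / 2 * \<bar>u\<bar>)" using d by (simp add: field_simps)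
      have "\<bar>(A + B * \<bar>u\<bar>) * weight b c u\<bar> = \<bar>A + B * \<bar>u\<bar>\<bar> * weight b c u" by (simp add: abs_mult)
      also have "\<dots> \<le> (\<bar>A\<bar> * 1 + \<bar>B\<bar> * \<bar>u\<bar>) * (K * exp (- d * \<bar>u\<bar>))"
        by (intro mult_mono w) (auto simp: abs_mult intro: order_trans[OF abs_triangle_ineq])
      also have "\<dots> \<le> (\<bar>A\<bar> * exp (d / 2 * \<bar>u\<bar>) + \<bar>B\<bar> * (2 / d * exp (d / 2 * \<bar>u\<bar>))) * (K * exp (- d * \<bar>u\<bar>))"
        using 1 2 K by (intro mult_right_mono add_mono mult_left_mono) auto
      also have "\<dots> = (\<bar>A\<bar> + \<bar>B\<bar> * 2 / d) * K * (exp (d / 2 * \<bar>u\<bar>) * exp (- d * \<bar>u\<bar>))"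
        by (simp add: algebra_simps)
      also have "exp (d / 2 * \<bar>u\<bar>) * exp (- d * \<bar>u\<bar>) = exp (- (d / 2) * \<bar>u\<bar>)"
        by (simp flip: exp_add)
      finally show ?thesis .
    qed
    then show "AE u in lborel. norm ((A + B * \<bar>u\<bar>) * weight b c u)
        \<le> norm ((\<bar>A\<bar> + \<bar>B\<bar> * 2 / d) * K * exp (- (d / 2) * \<bar>u\<bar>))"
      unfolding real_norm_def by (intro AE_I2) (rule order_trans[OF _ abs_ge_self])
  qed measurable
qed

lemma integrable_weight: "integrable lborel (weight b c)"
  using integrable_weight_linear[of 1 0 b c] by simp

definition znorm :: "real \<Rightarrow> real \<Rightarrow> real" where
  "znorm b c = (\<integral>u. weight b c u \<partial>lborel)"

lemma znorm_pos [simp]: "znorm b c > 0"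
proof -
  have "znorm b c \<noteq> 0"
  proof
    assume "znorm b c = 0"
    then have "AE u in lborel. weight b c u = 0"
      using integral_nonneg_eq_0_iff_AE[OF integrable_weight[of b c]] by (simp add: znorm_def)
    then have "AE u in (lborel :: real measure). False"
      by eventually_elim (metis weight_pos less_irrefl)
    then show False by (simp add: trivial_limit_def[symmetric] Measure_Space.ae_filter_eq_bot_iff)
  qed
  moreover have "znorm b c \<ge> 0" by (simp add: znorm_def)
  ultimately show ?thesis by simp
qed

lemma rho_eq: "rho V b c u = weight b c u / znorm b c"
  by (simp add: rho_def weight_def znorm_def)

lemma measurable_znorm [measurable]:
  assumes [measurable]: "f \<in> borel_measurable M" "g \<in> borel_measurable M"
  shows "(\<lambda>x. znorm (f x) (g x)) \<in> borel_measurable M"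
  unfolding znorm_def by measurable

lemma measurable_rho [measurable]:
  assumes [measurable]: "f \<in> borel_measurable M" "g \<in> borel_measurable M" "h \<in> borel_measurable M"
  shows "(\<lambda>x. rho V (f x) (g x) (h x)) \<in> borel_measurable M"
  unfolding rho_eq by measurable

lemma rho_pos [simp]: "rho V b c u > 0"
  by (simp add: rho_eq)

lemma rho_nonneg [simp]: "rho V b c u \<ge> 0"
  by (simp add: less_imp_le)

lemma integrable_rho: "integrable lborel (rho V b c)"
  using integrable_weight[of b c] by (simp add: rho_eq[abs_def])

lemma integral_rho [simp]: "(\<integral>u. rho V b c u \<partial>lborel) = 1"
proof -
  have "(\<integral>u. rho V b c u \<partial>lborel) = znorm b c / znorm b c"
    unfolding rho_eq by (simp add: znorm_def)
  also have "\<dots> = 1" using znorm_pos[of b c] by (intro divide_self) linarith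
  finally show ?thesis .
qed

lemma integrable_rho_growth:
  assumes [measurable]: "g \<in> borel_measurable borel" and g: "\<And>u. \<bar>g u\<bar> \<le> A + B * \<bar>u\<bar>"
  shows "integrable lborel (\<lambda>u. g u * rho V b c u)"
proof (rule Bochner_Integration.integrable_bound)
  show "integrable lborel (\<lambda>u. (A + B * \<bar>u\<bar>) * rho V b c u)"
    using integrable_divide[OF integrable_weight_linear[of A B b c], of "znorm b c"]
    by (simp only: rho_eq times_divide_eq_right)
  have "\<bar>g u\<bar> * rho V b c u \<le> \<bar>A + B * \<bar>u\<bar>\<bar> * rho V b c u" for u
    by (intro mult_right_mono order_trans[OF g abs_ge_self]) simp
  then show "AE u in lborel. norm (g u * rho V b c u) \<le> norm ((A + B * \<bar>u\<bar>) * rho V b c u)"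
    by (simp add: abs_mult)
qed measurable

lemma integrable_rho_Lipschitz:
  assumes [measurable]: "g \<in> borel_measurable borel" and g: "\<And>u v. \<bar>g u - g v\<bar> \<le> L * \<bar>u - v\<bar>"
  shows "integrable lborel (\<lambda>u. g u * rho V b c u)"
proof (rule integrable_rho_growth)
  show "\<bar>g u\<bar> \<le> \<bar>g 0\<bar> + L * \<bar>u\<bar>" for u using g[of u 0] by simp
qed measurable

lemma integrable_id_rho: "integrable lborel (\<lambda>u. u * rho V b c u)"
  by (rule integrable_rho_Lipschitz[where L = 1]) auto

text \<open>The reflection \<^term>\<open>\<lambda>u. b + c - u\<close> exchanges the two factors of the weight.\<close>

lemma mean_rho: "(\<integral>u. u * rho V b c u \<partial>lborel) = (b + c) / 2"
proof -
  have refl: "rho V b c (b + c - u) = rho V b c u" for u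
  proof -
    have "b + c - u - b = c - u" "c - (b + c - u) = u - b" by auto
    then show ?thesis by (simp only: rho_eq weight_def) simp
  qed
  have "(\<integral>u. u * rho V b c u \<partial>lborel) = (\<integral>u. (b + c - u) * rho V b c (b + c - u) \<partial>lborel)"
    using lborel_integral_real_affine[of "- 1" "\<lambda>u. u * rho V b c u" "b + c"] by simp
  also have "\<dots> = (\<integral>u. (b + c) * rho V b c u - u * rho V b c u \<partial>lborel)"
    by (simp add: refl left_diff_distrib)
  also have "\<dots> = (b + c) - (\<integral>u. u * rho V b c u \<partial>lborel)"
    using integrable_rho[of b c] integrable_id_rho[of b c] by simp
  finally show ?thesis by simp
qed

text \<open>The ratio of the two densities is nondecreasing, so their difference changes sign at most
  once, from negative to positive.\<close>

lemma rho_stochastically_monotone: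
  assumes le: "b \<le> b'" "c \<le> c'" and h: "mono h"
    and int: "integrable lborel (\<lambda>u. h u * rho V b c u)" "integrable lborel (\<lambda>u. h u * rho V b' c' u)"
  shows "(\<integral>u. h u * rho V b c u \<partial>lborel) \<le> (\<integral>u. h u * rho V b' c' u \<partial>lborel)"
proof -
  let ?r = "rho V b c" and ?r' = "rho V b' c'"
  \<comment> \<open>Monotone likelihood ratio. Each exchange inequality pairs the two extreme
    arguments against the two middle ones: the extremes are \<open>u - b'\<close> and
    \<open>v - b\<close> in the first, \<open>c - v\<close> and \<open>c' - u\<close> in the
    second.\<close>
  have ratio: "?r' u * ?r v \<le> ?r' v * ?r u" if "u \<le> v" for u v
  proof -
    have "V (v - b') + V (u - b) \<le> V (u - b') + V (v - b)"
      using that le by (intro convex_on_exchange[OF convex_V]) auto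
    moreover have "V (c' - v) + V (c - u) \<le> V (c - v) + V (c' - u)"
      using that le by (intro convex_on_exchange[OF convex_V]) auto
    ultimately have "weight b' c' u * weight b c v \<le> weight b' c' v * weight b c u"
      by (simp add: weight_def flip: exp_add)
    then show ?thesis
      by (simp add: rho_eq divide_right_mono less_imp_le mult.commute[of "znorm b c"])
  qed
  have cross: "v \<le> u" if "?r u < ?r' u" "?r' v < ?r v" for u v
  proof (rule ccontr)
    assume "\<not> v \<le> u"
    then have "?r' u * ?r v \<le> ?r' v * ?r u" by (intro ratio) simp
    moreover have "?r u * ?r' v < ?r' u * ?r v"
      using that by (intro mult_strict_mono) auto
    ultimately show False by (simp add: mult.commute)
  qed
  show ?thesis
  proof (cases "(\<exists>u. ?r u < ?r' u) \<and> (\<exists>v. ?r' v < ?r v)")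
    case True
    then obtain u0 v0 where uv: "?r u0 < ?r' u0" "?r' v0 < ?r v0" by blast
    \<comment> \<open>\<open>t\<close> is the crossing point: the set where \<open>?r'\<close> is
      smaller lies to its left, the set where it is larger to its right. Hence
      \<open>h u - h t\<close> and \<open>?r' u - ?r u\<close> never have opposite signs.\<close>
    define t where "t = Sup {v. ?r' v < ?r v}"
    have bdd: "bdd_above {v. ?r' v < ?r v}" using cross[OF uv(1)] by (auto intro!: bdd_aboveI)
    have up: "v \<le> t" if "?r' v < ?r v" for v
      unfolding t_def using that bdd by (intro cSup_upper) auto
    have lo: "t \<le> u" if "?r u < ?r' u" for u
      unfolding t_def using uv cross[OF that] by (intro cSup_least) auto
    have "0 \<le> (h u - h t) * (?r' u - ?r u)" for u
    proof (cases "?r u < ?r' u")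
      case True
      then show ?thesis using monoD[OF h lo[OF True]] by simp
    next
      case False
      show ?thesis
      proof (cases "?r' u < ?r u")
        case True
        then show ?thesis using monoD[OF h up[OF True]] by (simp add: mult_nonpos_nonpos)
      qed (use False in simp)
    qed
    then have "0 \<le> (\<integral>u. (h u - h t) * (?r' u - ?r u) \<partial>lborel)" by (intro integral_nonneg_AE) auto
    also have "\<dots> = (\<integral>u. (h u * ?r' u - h u * ?r u) - (h t * ?r' u - h t * ?r u) \<partial>lborel)"
      by (intro Bochner_Integration.integral_cong) (auto simp: algebra_simps)
    \<comment> \<open>The terms with \<open>h t\<close> cancel because both densities have total
      mass one.\<close>
    also have "\<dots> = (\<integral>u. h u * ?r' u \<partial>lborel) - (\<integral>u. h u * ?r u \<partial>lborel)"
      using int integrable_rho[of b c] integrable_rho[of b' c'] by simp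
    finally show ?thesis by simp
  next
    case False
    \<comment> \<open>Without a sign change the difference has constant sign and integral zero, so
      the densities agree almost everywhere.\<close>
    have "AE u in lborel. ?r' u - ?r u = 0"
    proof (cases "\<exists>u. ?r u < ?r' u")
      case True
      with False have "0 \<le> ?r' u - ?r u" for u by (meson diff_ge_0_iff_ge not_less)
      then show ?thesis
        using integral_nonneg_eq_0_iff_AE[of lborel "\<lambda>u. ?r' u - ?r u"]
          integrable_rho[of b c] integrable_rho[of b' c'] by simp
    next
      case F: False
      then have "0 \<le> ?r u - ?r' u" for u by (meson diff_ge_0_iff_ge not_less)
      then have "AE u in lborel. ?r u - ?r' u = 0"
        using integral_nonneg_eq_0_iff_AE[of lborel "\<lambda>u. ?r u - ?r' u"]
          integrable_rho[of b c] integrable_rho[of b' c'] by simp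
      then show ?thesis by eventually_elim simp
    qed
    then have "(\<integral>u. h u * ?r u \<partial>lborel) = (\<integral>u. h u * ?r' u \<partial>lborel)"
      using int by (intro integral_cong_AE) auto
    then show ?thesis by simp
  qed
qed

text \<open>Since \<^term>\<open>L * u - g u\<close> is nondecreasing, the difference of the integrals of \<^term>\<open>g\<close> is at
  most \<^term>\<open>L\<close> times the difference of the means.\<close>

lemma rho_Lipschitz_ordered:
  assumes le: "b \<le> b'" "c \<le> c'" and [measurable]: "g \<in> borel_measurable borel"
    and g: "\<And>u v. \<bar>g u - g v\<bar> \<le> L * \<bar>u - v\<bar>"
  shows "(\<integral>u. g u * rho V b' c' u \<partial>lborel) - (\<integral>u. g u * rho V b c u \<partial>lborel)
    \<le> L * ((b' - b) + (c' - c)) / 2"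
proof -
  have int: "integrable lborel (\<lambda>u. L * (u * rho V b c u) - g u * rho V b c u)" for b c
    using integrable_id_rho[of b c] integrable_rho_Lipschitz[OF assms(3) g, of b c] by simp
  have *: "(\<integral>u. (L * u - g u) * rho V b c u \<partial>lborel) = L * ((b + c) / 2) - (\<integral>u. g u * rho V b c u \<partial>lborel)" for b c
    using integrable_id_rho[of b c] integrable_rho_Lipschitz[OF assms(3) g, of b c]
    by (simp add: left_diff_distrib mult.assoc mean_rho)
  have "mono (\<lambda>u. L * u - g u)"
  proof (rule monoI)
    fix u v :: real assume "u \<le> v"
    then show "L * u - g u \<le> L * v - g v" using g[of v u] by (simp add: abs_le_iff algebra_simps)
  qed
  then have "(\<integral>u. (L * u - g u) * rho V b c u \<partial>lborel) \<le> (\<integral>u. (L * u - g u) * rho V b' c' u \<partial>lborel)"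
    using int by (intro rho_stochastically_monotone le) (auto simp: left_diff_distrib mult.assoc)
  then show ?thesis unfolding * by (simp add: field_simps)
qed

lemma rho_Lipschitz_abs_ordered:
  assumes "b \<le> b'" "c \<le> c'" and [measurable]: "g \<in> borel_measurable borel"
    and g: "\<And>u v. \<bar>g u - g v\<bar> \<le> L * \<bar>u - v\<bar>"
  shows "\<bar>(\<integral>u. g u * rho V b' c' u \<partial>lborel) - (\<integral>u. g u * rho V b c u \<partial>lborel)\<bar>
    \<le> L * ((b' - b) + (c' - c)) / 2"
proof -
  have "\<bar>- g u - - g v\<bar> \<le> L * \<bar>u - v\<bar>" for u v using g[of v u] by (simp add: abs_minus_commute)
  from rho_Lipschitz_ordered[OF assms(1,2) _ this]
  have "(\<integral>u. g u * rho V b c u \<partial>lborel) - (\<integral>u. g u * rho V b' c' u \<partial>lborel)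
      \<le> L * ((b' - b) + (c' - c)) / 2" by simp
  moreover note rho_Lipschitz_ordered[OF assms]
  ultimately show ?thesis unfolding abs_le_iff minus_diff_eq by (rule conjI[rotated])
qed

lemma rho_Lipschitz:
  assumes [measurable]: "g \<in> borel_measurable borel"
    and g: "\<And>u v. \<bar>g u - g v\<bar> \<le> L * \<bar>u - v\<bar>"
  shows "\<bar>(\<integral>u. g u * rho V b c u \<partial>lborel) - (\<integral>u. g u * rho V b' c' u \<partial>lborel)\<bar>
    \<le> L * (\<bar>b - b'\<bar> + \<bar>c - c'\<bar>) / 2"
proof -
  define I where "I b c = (\<integral>u. g u * rho V b c u \<partial>lborel)" for b c
  have 1: "\<bar>I b c - I b' c\<bar> \<le> L * \<bar>b - b'\<bar> / 2"
    using rho_Lipschitz_abs_ordered[OF _ order_refl assms, of b b' c]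
      rho_Lipschitz_abs_ordered[OF _ order_refl assms, of b' b c]
    by (cases "b \<le> b'") (auto simp: I_def abs_minus_commute)
  have 2: "\<bar>I b' c - I b' c'\<bar> \<le> L * \<bar>c - c'\<bar> / 2"
    using rho_Lipschitz_abs_ordered[OF order_refl _ assms, of c c' b']
      rho_Lipschitz_abs_ordered[OF order_refl _ assms, of c' c b']
    by (cases "c \<le> c'") (auto simp: I_def abs_minus_commute)
  have "\<bar>I b c - I b' c'\<bar> \<le> L * \<bar>b - b'\<bar> / 2 + L * \<bar>c - c'\<bar> / 2"
    using 1 2 by linarith
  then show ?thesis by (simp add: I_def algebra_simps add_divide_distrib)
qed

end

section \<open>The Gibbs measure\<close>

declare One_nat_def [simp del]

locale gibbs_sampler = potential +
  fixes N :: nat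
  assumes N: "N \<ge> 2"
begin

abbreviation "S \<equiv> restrict_space (Pi\<^sub>M {0..N} (\<lambda>_. borel :: real measure)) (Omega N)"

abbreviation "B \<equiv> Pi\<^sub>M {1..<N} (\<lambda>_. lborel :: real measure)"

abbreviation "\<mu> \<equiv> gibbs V N"

lemma space_S [simp]: "space S = Omega N"
  by (auto simp: space_restrict_space space_PiM Omega_def)

lemma sets_reference [measurable_cong]: "sets (reference_measure N) = sets S"
  by (simp add: reference_measure_def)

lemma space_reference [simp]: "space (reference_measure N) = Omega N"
  using sets_eq_imp_space_eq[OF sets_reference] by simp

lemma sets_gibbs [measurable_cong]: "sets \<mu> = sets S"
  by (simp add: gibbs_def sets_reference)

lemma space_gibbs [simp]: "space \<mu> = Omega N"
  using sets_eq_imp_space_eq[OF sets_gibbs] by simp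

lemma measurable_coord: "k \<le> N \<Longrightarrow> (\<lambda>x. x k) \<in> borel_measurable S"
  by (rule measurable_restrict_space1) (rule measurable_component_singleton, auto)

lemma pin_in_Omega: "pin N y \<in> Omega N"
  using N by (auto simp: pin_def Omega_def)

lemma measurable_pin [measurable]: "pin N \<in> measurable B S"
proof (rule measurable_restrict_space2)
  show "pin N \<in> measurable B (Pi\<^sub>M {0..N} (\<lambda>_. borel))"
    unfolding pin_def
  proof (rule measurable_restrict)
    fix k assume "k \<in> {0..N}"
    have "(\<lambda>y. if k \<in> {1..<N} then y k else 0) \<in> borel_measurable B"
    proof (cases "k \<in> {1..<N}")
      case True
      then have "(\<lambda>y. y k) \<in> measurable B lborel" by (rule measurable_component_singleton)
      then show ?thesis using True by simp
    next
      case False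
      then show ?thesis by (simp only: if_False) simp
    qed
    then show "(\<lambda>x. if k \<in> {1..<N} then x k else 0) \<in> borel_measurable B" .
  qed
qed (use pin_in_Omega in auto)

lemma upd_in_Omega: "x \<in> Omega N \<Longrightarrow> k \<in> {1..<N} \<Longrightarrow> x(k := u) \<in> Omega N"
  by (auto simp: Omega_def PiE_def extensional_def)

lemma pin_upd: "k \<in> {1..<N} \<Longrightarrow> pin N (y(k := v)) = (pin N y)(k := v)"
  by (auto simp: pin_def fun_eq_iff)

lemma measurable_upd:
  assumes k: "k \<in> {1..<N}"
  shows "(\<lambda>(x, u). x(k := u)) \<in> measurable (S \<Otimes>\<^sub>M lborel) S"
proof (rule measurable_restrict_space2)
  show "(\<lambda>(x, u). x(k := u)) \<in> measurable (S \<Otimes>\<^sub>M lborel) (Pi\<^sub>M {0..N} (\<lambda>_. borel))"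
    unfolding split_beta
  proof (rule measurable_fun_upd[where J = "{0..N}"])
    show "{0..N} = {0..N} \<union> {k}" using k by auto
    have "fst \<in> measurable (S \<Otimes>\<^sub>M lborel) S" by simp
    moreover have "(\<lambda>x. x) \<in> measurable S (Pi\<^sub>M {0..N} (\<lambda>_. borel))"
      by (rule measurable_restrict_space1) simp
    ultimately show "fst \<in> measurable (S \<Otimes>\<^sub>M (lborel::real measure)) (Pi\<^sub>M {0..N} (\<lambda>_. borel))"
      by (rule measurable_compose)
  qed simp
qed (use k in \<open>auto simp: space_pair_measure intro: upd_in_Omega\<close>)

lemma measurable_hamiltonian [measurable]: "hamiltonian V N \<in> borel_measurable S"
  unfolding hamiltonian_def
proof (rule borel_measurable_sum)
  fix k assume "k \<in> {1..N}"
  then have [measurable]: "(\<lambda>x. x k) \<in> borel_measurable S" "(\<lambda>x. x (k - 1)) \<in> borel_measurable S"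
    by (auto intro!: measurable_coord)
  show "(\<lambda>x. V (x k - x (k - 1))) \<in> borel_measurable S" by measurable
qed

lemma nn_integral_reference:
  assumes [measurable]: "F \<in> borel_measurable S"
  shows "(\<integral>\<^sup>+x. F x \<partial>reference_measure N) = (\<integral>\<^sup>+y. F (pin N y) \<partial>B)"
  unfolding reference_measure_def by (rule nn_integral_distr) measurable

lemma integrable_reference:
  fixes F :: "_ \<Rightarrow> real"
  assumes [measurable]: "F \<in> borel_measurable S"
  shows "integrable (reference_measure N) F \<longleftrightarrow> integrable B (\<lambda>y. F (pin N y))"
  unfolding reference_measure_def by (rule integrable_distr_eq) measurable

text \<open>Along a pinned path the tilts telescope to \<open>a * (x N - x 0) = 0\<close>. What
  remains is \<open>d\<close> times the total variation, which bounds every single height. Summing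
  over fewer than \<open>N\<close> heights replaces \<open>d\<close> by \<open>d / N\<close>, and
  the \<open>N\<close> increments cost \<open>N * C\<close>.\<close>

lemma hamiltonian_lower_bound:
  obtains d C where "d > 0"
    "\<And>x. x \<in> Omega N \<Longrightarrow> hamiltonian V N x \<ge> d * (\<Sum>j\<in>{1..<N}. \<bar>x j\<bar>) - C"
proof -
  obtain a d C where d: "d > 0" and low: "\<And>t. V t \<ge> a * t + d * \<bar>t\<bar> - C"
    using potentials_lower_bound[OF V] by metis
  have "hamiltonian V N x \<ge> d / real N * (\<Sum>j\<in>{1..<N}. \<bar>x j\<bar>) - real N * C" if x: "x \<in> Omega N" for x
  proof -
    have x0: "x 0 = 0" "x N = 0" using x by (auto simp: Omega_def)
    define s where "s n = (\<Sum>k=1..n. \<bar>x k - x (k - 1)\<bar>)" for n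
    have tele: "(\<Sum>k=1..n. x k - x (k - 1)) = x n - x 0" for n by (induction n) auto
    have le: "\<bar>x n\<bar> \<le> s n" for n
      using sum_abs[of "\<lambda>k. x k - x (k - 1)" "{1..n}"] unfolding tele x0 s_def by simp
    have "(\<Sum>j\<in>{1..<N}. \<bar>x j\<bar>) \<le> (\<Sum>j\<in>{1..<N}. s N)"
    proof (rule sum_mono)
      fix j assume "j \<in> {1..<N}"
      then have "s j \<le> s N" unfolding s_def by (intro sum_mono2) auto
      then show "\<bar>x j\<bar> \<le> s N" using le[of j] by simp
    qed
    also have "\<dots> = real (N - 1) * s N" by simp
    also have "\<dots> \<le> real N * s N" by (intro mult_right_mono) (auto simp: s_def sum_nonneg)
    finally have "d / real N * (\<Sum>j\<in>{1..<N}. \<bar>x j\<bar>) \<le> d / real N * (real N * s N)"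
      using d by (intro mult_left_mono) auto
    also have "\<dots> = d * s N" using N by simp
    finally have 1: "d / real N * (\<Sum>j\<in>{1..<N}. \<bar>x j\<bar>) \<le> d * s N" .
    have "hamiltonian V N x \<ge> (\<Sum>k=1..N. a * (x k - x (k - 1)) + d * \<bar>x k - x (k - 1)\<bar> - C)"
      unfolding hamiltonian_def by (intro sum_mono low)
    also have "(\<Sum>k=1..N. a * (x k - x (k - 1)) + d * \<bar>x k - x (k - 1)\<bar> - C)
        = (\<Sum>k=1..N. a * (x k - x (k - 1))) + (\<Sum>k=1..N. d * \<bar>x k - x (k - 1)\<bar>) - real N * C"
      by (simp add: sum.distrib sum_subtractf)
    also have "\<dots> = a * (x N - x 0) + d * s N - real N * C"
      by (simp only: sum_distrib_left[symmetric] tele s_def)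
    finally show ?thesis using 1 x0 by simp
  qed
  moreover have "d / real N > 0" using d N by simp
  ultimately show ?thesis using that by blast
qed

sublocale PF: product_sigma_finite "\<lambda>_ :: nat. lborel :: real measure" ..

text \<open>One integrability statement serves two purposes: the summand 1 yields a finite partition
  function, the square yields second moments of the heights. Half of the exponential decay absorbs
  the polynomial; the other half factorises over the coordinates.\<close>

lemma integrable_moment:
  "integrable (reference_measure N) (\<lambda>x. (1 + (\<Sum>j\<in>{1..<N}. \<bar>x j\<bar>)\<^sup>2) * exp (- hamiltonian V N x))"
proof -
  have [measurable]: "(\<lambda>x. \<Sum>j\<in>{1..<N}. \<bar>x j\<bar>) \<in> borel_measurable S"
    by (intro borel_measurable_sum borel_measurable_abs measurable_coord) auto
  obtain d C where d: "d > 0"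
    and low: "\<And>x. x \<in> Omega N \<Longrightarrow> hamiltonian V N x \<ge> d * (\<Sum>j\<in>{1..<N}. \<bar>x j\<bar>) - C"
    using hamiltonian_lower_bound by metis
  show ?thesis
  proof (subst integrable_reference)
    \<comment> \<open>The exponent \<open>d / 4\<close> is taken so that squaring
      \<open>s \<le> 4 / d * exp (d / 4 * s)\<close> uses exactly half of the decay.\<close>
    have bound: "(1 + s\<^sup>2) * exp (- h) \<le> (1 + (4 / d)\<^sup>2) * exp C * exp (- (d / 2) * s)"
      if "0 \<le> s" "h \<ge> d * s - C" for s h :: real
    proof -
      have "d / 4 * s \<le> exp (d / 4 * s)" using exp_ge_add_one_self[of "d / 4 * s"] by linarith
      then have "s \<le> 4 / d * exp (d / 4 * s)" using d by (simp add: field_simps)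
      then have "s\<^sup>2 \<le> (4 / d * exp (d / 4 * s))\<^sup>2" using that by (intro power_mono) auto
      also have "\<dots> = (4 / d)\<^sup>2 * exp (d / 2 * s)"
        by (simp add: power_mult_distrib power_divide flip: exp_of_nat_mult)
      finally have 1: "s\<^sup>2 \<le> (4 / d)\<^sup>2 * exp (d / 2 * s)" .
      have 2: "1 \<le> exp (d / 2 * s)" using d that by simp
      have 3: "exp (- h) \<le> exp (C - d * s)" using that by simp
      have "(1 + s\<^sup>2) * exp (- h) \<le> (exp (d / 2 * s) + (4 / d)\<^sup>2 * exp (d / 2 * s)) * exp (C - d * s)"
        using 1 2 3 by (intro mult_mono add_mono) auto
      also have "\<dots> = (1 + (4 / d)\<^sup>2) * (exp (d / 2 * s) * exp (C - d * s))"
        by (simp only: distrib_right distrib_left mult.assoc mult_1)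
      also have "exp (d / 2 * s) * exp (C - d * s) = exp C * exp (- (d / 2) * s)"
        by (simp flip: exp_add)
      finally show ?thesis by (simp add: mult.assoc)
    qed
    show "integrable B (\<lambda>y. (1 + (\<Sum>j\<in>{1..<N}. \<bar>pin N y j\<bar>)\<^sup>2) * exp (- hamiltonian V N (pin N y)))"
    proof (rule Bochner_Integration.integrable_bound)
      have "integrable B (\<lambda>y. \<Prod>j\<in>{1..<N}. exp (- (d / 2) * \<bar>y j\<bar>))"
        using d by (intro PF.product_integrable_prod integrable_exp_neg_abs) auto
      then show "integrable B (\<lambda>y. (1 + (4 / d)\<^sup>2) * exp C * exp (- (d / 2) * (\<Sum>j\<in>{1..<N}. \<bar>pin N y j\<bar>)))"
        by (intro integrable_mult_right) (simp add: sum_distrib_left exp_sum pin_def)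
      show "(\<lambda>y. (1 + (\<Sum>j\<in>{1..<N}. \<bar>pin N y j\<bar>)\<^sup>2) * exp (- hamiltonian V N (pin N y))) \<in> borel_measurable B"
        by measurable
      have "\<bar>(1 + (\<Sum>j\<in>{1..<N}. \<bar>pin N y j\<bar>)\<^sup>2) * exp (- hamiltonian V N (pin N y))\<bar>
        \<le> (1 + (4 / d)\<^sup>2) * exp C * exp (- (d / 2) * (\<Sum>j\<in>{1..<N}. \<bar>pin N y j\<bar>))" for y
      proof -
        have "0 \<le> (\<Sum>j\<in>{1..<N}. \<bar>pin N y j\<bar>)" by (simp add: sum_nonneg)
        from bound[OF this low[OF pin_in_Omega]] show ?thesis by (simp add: abs_mult)
      qed
      then show "AE y in B. norm ((1 + (\<Sum>j\<in>{1..<N}. \<bar>pin N y j\<bar>)\<^sup>2) * exp (- hamiltonian V N (pin N y)))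
        \<le> norm ((1 + (4 / d)\<^sup>2) * exp C * exp (- (d / 2) * (\<Sum>j\<in>{1..<N}. \<bar>pin N y j\<bar>)))"
        unfolding real_norm_def by (intro AE_I2) (rule order_trans[OF _ abs_ge_self])
    qed
  qed measurable
qed

lemma integrable_exp_hamiltonian: "integrable (reference_measure N) (\<lambda>x. exp (- hamiltonian V N x))"
proof (rule Bochner_Integration.integrable_bound[OF integrable_moment])
  have "1 * exp (- hamiltonian V N x) \<le> (1 + (\<Sum>j\<in>{1..<N}. \<bar>x j\<bar>)\<^sup>2) * exp (- hamiltonian V N x)" for x
    by (intro mult_right_mono) auto
  then show "AE x in reference_measure N. norm (exp (- hamiltonian V N x))
      \<le> norm ((1 + (\<Sum>j\<in>{1..<N}. \<bar>x j\<bar>)\<^sup>2) * exp (- hamiltonian V N x))"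
    by (auto simp: abs_mult)
qed measurable

lemma partition_function_pos: "partition_function V N > 0"
proof -
  have "partition_function V N \<noteq> 0"
  proof
    assume "partition_function V N = 0"
    then have "AE x in reference_measure N. exp (- hamiltonian V N x) = 0"
      using integral_nonneg_eq_0_iff_AE[OF integrable_exp_hamiltonian] by (simp add: partition_function_def)
    then have "AE x in reference_measure N. False" by eventually_elim simp
    then have "emeasure (reference_measure N) (Omega N) = 0"
      by (simp add: trivial_limit_def[symmetric] Measure_Space.ae_filter_eq_bot_iff)
    moreover have "emeasure (reference_measure N) (Omega N) = emeasure B (Pi\<^sub>E {1..<N} (\<lambda>_. UNIV))"
    proof -
      have "emeasure (reference_measure N) (Omega N) = emeasure B (pin N -` Omega N \<inter> space B)"
        unfolding reference_measure_def using sets.top[of S] by (intro emeasure_distr) auto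
      also have "pin N -` Omega N \<inter> space B = Pi\<^sub>E {1..<N} (\<lambda>_. UNIV)"
        using pin_in_Omega by (auto simp: space_PiM)
      finally show ?thesis .
    qed
    moreover have "emeasure B (Pi\<^sub>E {1..<N} (\<lambda>_. UNIV)) \<noteq> 0"
      by (subst PF.emeasure_PiM) auto
    ultimately show False by simp
  qed
  moreover have "partition_function V N \<ge> 0" by (simp add: partition_function_def)
  ultimately show ?thesis by simp
qed

definition gibbs_density :: "(nat \<Rightarrow> real) \<Rightarrow> real" where
  "gibbs_density x = exp (- hamiltonian V N x) / partition_function V N"

lemma gibbs_density_pos: "gibbs_density x > 0"
  by (simp add: gibbs_density_def partition_function_pos)

lemma measurable_gibbs_density [measurable]: "gibbs_density \<in> borel_measurable S"
  unfolding gibbs_density_def by measurable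

lemma gibbs_eq: "\<mu> = density (reference_measure N) (\<lambda>x. ennreal (gibbs_density x))"
  by (simp add: gibbs_def gibbs_density_def)

sublocale prob_space \<mu>
proof
  have "emeasure \<mu> (Omega N) = (\<integral>\<^sup>+x. ennreal (gibbs_density x) * indicator (Omega N) x \<partial>reference_measure N)"
    unfolding gibbs_eq using sets.top[of S] by (intro emeasure_density) (simp_all add: sets_reference)
  also have "\<dots> = (\<integral>\<^sup>+x. ennreal (gibbs_density x) \<partial>reference_measure N)"
    by (intro nn_integral_cong) auto
  also have "\<dots> = ennreal (\<integral>x. gibbs_density x \<partial>reference_measure N)"
    unfolding gibbs_density_def by (intro nn_integral_eq_integral integrable_divide integrable_exp_hamiltonian)
      (simp add: partition_function_pos less_imp_le)
  also have "(\<integral>x. gibbs_density x \<partial>reference_measure N) = 1"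
    using partition_function_pos unfolding gibbs_density_def by (simp add: partition_function_def[symmetric])
  finally show "emeasure \<mu> (space \<mu>) = 1" by simp
qed

lemma nn_integral_gibbs:
  assumes [measurable]: "F \<in> borel_measurable S"
  shows "(\<integral>\<^sup>+x. F x \<partial>\<mu>) = (\<integral>\<^sup>+y. ennreal (gibbs_density (pin N y)) * F (pin N y) \<partial>B)"
proof -
  have "(\<integral>\<^sup>+x. F x \<partial>\<mu>) = (\<integral>\<^sup>+x. ennreal (gibbs_density x) * F x \<partial>reference_measure N)"
    unfolding gibbs_eq by (rule nn_integral_density) measurable
  also have "\<dots> = (\<integral>\<^sup>+y. ennreal (gibbs_density (pin N y)) * F (pin N y) \<partial>B)"
    by (rule nn_integral_reference) measurable
  finally show ?thesis .
qed

section \<open>Conditional laws and reversibility of one update\<close>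

text \<open>Only the increments with indices \<open>k\<close> and \<open>k + 1\<close> involve the
  height at \<open>k\<close>; all others form a factor independent of \<open>v\<close>. So
  \<open>rho\<close> is the conditional density of one height given the others, and \<open>G\<close>
  is the unnormalised weight of those others.\<close>

lemma gibbs_density_upd:
  assumes k: "k \<in> {1..<N}"
  obtains G where "\<And>v. gibbs_density (x(k := v)) = G * rho V (x (k - 1)) (x (k + 1)) v" "0 \<le> G"
proof -
  define R where "R = (\<Sum>j\<in>{1..N} - {k, k + 1}. V (x j - x (j - 1)))"
  have H: "hamiltonian V N (x(k := v)) = V (v - x (k - 1)) + V (x (k + 1) - v) + R" for v
  proof -
    let ?x = "x(k := v)"
    have "hamiltonian V N ?x = (\<Sum>j\<in>insert k (insert (k + 1) ({1..N} - {k, k + 1})). V (?x j - ?x (j - 1)))"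
      unfolding hamiltonian_def using k by (intro sum.cong) auto
    also have "\<dots> = V (?x k - ?x (k - 1)) + (V (?x (k + 1) - ?x k)
        + (\<Sum>j\<in>{1..N} - {k, k + 1}. V (?x j - ?x (j - 1))))"
      by simp
    also have "(\<Sum>j\<in>{1..N} - {k, k + 1}. V (?x j - ?x (j - 1))) = R"
      unfolding R_def by (intro sum.cong) auto
    finally have "hamiltonian V N ?x = V (?x k - ?x (k - 1)) + (V (?x (k + 1) - ?x k) + R)" .
    moreover have "k - 1 \<noteq> k" using k by auto
    ultimately show ?thesis by simp
  qed
  show ?thesis
  proof
    let ?b = "x (k - 1)" and ?c = "x (k + 1)"
    show "gibbs_density (x(k := v)) = (exp (- R) * znorm ?b ?c / partition_function V N) * rho V ?b ?c v" for v
    proof -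
      have "znorm ?b ?c \<noteq> 0" by (metis znorm_pos less_irrefl)
      then show ?thesis by (simp add: gibbs_density_def H rho_eq weight_def exp_diff exp_minus exp_add field_simps)
    qed
    show "0 \<le> exp (- R) * znorm ?b ?c / partition_function V N"
      using znorm_pos[of ?b ?c] partition_function_pos by (simp add: less_imp_le)
  qed
qed

text \<open>Tonelli with coordinate \<open>k\<close> integrated innermost, so that a single-site
  identity can be checked line by line.\<close>

lemma nn_integral_gibbs_section:
  assumes k: "k \<in> {1..<N}" and [measurable]: "F \<in> borel_measurable S"
  shows "(\<integral>\<^sup>+x. F x \<partial>\<mu>)
    = (\<integral>\<^sup>+y. \<integral>\<^sup>+v. ennreal (gibbs_density ((pin N y)(k := v))) * F ((pin N y)(k := v)) \<partial>lborel \<partial>Pi\<^sub>M ({1..<N} - {k}) (\<lambda>_. lborel))"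
proof -
  have ins: "insert k ({1..<N} - {k}) = {1..<N}" using k by auto
  have meas: "(\<lambda>y. ennreal (gibbs_density (pin N y)) * F (pin N y))
      \<in> borel_measurable (Pi\<^sub>M (insert k ({1..<N} - {k})) (\<lambda>_. lborel))"
    unfolding ins by measurable
  have "(\<integral>\<^sup>+x. F x \<partial>\<mu>) = (\<integral>\<^sup>+y. ennreal (gibbs_density (pin N y)) * F (pin N y) \<partial>Pi\<^sub>M (insert k ({1..<N} - {k})) (\<lambda>_. lborel))"
    unfolding ins by (rule nn_integral_gibbs) measurable
  also have "\<dots> = (\<integral>\<^sup>+y. \<integral>\<^sup>+v. ennreal (gibbs_density (pin N (y(k := v)))) * F (pin N (y(k := v))) \<partial>lborel \<partial>Pi\<^sub>M ({1..<N} - {k}) (\<lambda>_. lborel))"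
    by (rule PF.product_nn_integral_insert[OF _ _ meas]) auto
  finally show ?thesis using k by (simp add: pin_upd)
qed

lemma measurable_line:
  assumes k: "k \<in> {1..<N}" and x: "x \<in> Omega N"
  shows "(\<lambda>u. x(k := u)) \<in> measurable lborel S"
  using measurable_compose[OF measurable_Pair1' measurable_upd[OF k], of x] x by simp

lemma measurable_ennreal_rho: "(\<lambda>v. ennreal (rho V b c v)) \<in> borel_measurable lborel"
  by measurable

text \<open>On a line in direction \<open>k\<close> the joint density of old value \<open>v\<close>
  and new value \<open>u\<close> is a constant times \<open>r v * r u\<close>, because the update
  does not look at the old value. This is symmetric, so exchanging the order of integration
  exchanges old and new state.\<close>

lemma gibbs_reversible:
  assumes k: "k \<in> {1..<N}" and [measurable]: "F \<in> borel_measurable (S \<Otimes>\<^sub>M S)"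
  shows "(\<integral>\<^sup>+x. \<integral>\<^sup>+u. F (x, x(k := u)) * ennreal (rho V (x (k - 1)) (x (k + 1)) u) \<partial>lborel \<partial>\<mu>)
      = (\<integral>\<^sup>+x. \<integral>\<^sup>+u. F (x(k := u), x) * ennreal (rho V (x (k - 1)) (x (k + 1)) u) \<partial>lborel \<partial>\<mu>)"
proof -
  note [measurable] = measurable_upd[OF k]
  have [measurable]: "(\<lambda>x. x (k - 1)) \<in> borel_measurable S" "(\<lambda>x. x (k + 1)) \<in> borel_measurable S"
    using k by (auto intro!: measurable_coord)
  have inner: "(\<integral>\<^sup>+v. ennreal (gibbs_density (x(k := v))) *
        (\<integral>\<^sup>+u. F (x(k := v), x(k := v, k := u)) * ennreal (rho V ((x(k := v)) (k - 1)) ((x(k := v)) (k + 1)) u) \<partial>lborel) \<partial>lborel)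
    = (\<integral>\<^sup>+v. ennreal (gibbs_density (x(k := v))) *
        (\<integral>\<^sup>+u. F (x(k := v, k := u), x(k := v)) * ennreal (rho V ((x(k := v)) (k - 1)) ((x(k := v)) (k + 1)) u) \<partial>lborel) \<partial>lborel)"
    (is "?L = ?R") if x: "x \<in> Omega N" for x
  proof -
    obtain G where G: "\<And>v. gibbs_density (x(k := v)) = G * rho V (x (k - 1)) (x (k + 1)) v" "0 \<le> G"
      using gibbs_density_upd[OF k, of x] by metis
    define r where "r v = ennreal (rho V (x (k - 1)) (x (k + 1)) v)" for v
    define l where "l v = x(k := v)" for v
    have [measurable]: "r \<in> borel_measurable lborel"
      unfolding r_def[abs_def] by (rule measurable_ennreal_rho)
    have [measurable]: "l \<in> measurable lborel S"
      unfolding l_def[abs_def] by (rule measurable_line[OF k x])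
    have k1: "(x(k := v)) (k - 1) = x (k - 1)" "(x(k := v)) (k + 1) = x (k + 1)" for v
      using k by auto
    have gibbs_density: "ennreal (gibbs_density (x(k := v))) = ennreal G * r v" for v
      using G by (simp add: ennreal_mult r_def)
    have "?L = (\<integral>\<^sup>+v. \<integral>\<^sup>+u. ennreal G * r v * (F (l v, l u) * r u) \<partial>lborel \<partial>lborel)"
      unfolding gibbs_density k1 fun_upd_upd unfolding l_def[symmetric] r_def[symmetric]
      by (intro nn_integral_cong nn_integral_cmult[symmetric]) measurable
    \<comment> \<open>Tonelli, together with renaming the two variables into each other.\<close>
    also have "\<dots> = (\<integral>\<^sup>+v. \<integral>\<^sup>+u. ennreal G * r u * (F (l u, l v) * r v) \<partial>lborel \<partial>lborel)"
    proof -
      have "(\<lambda>(u, v). ennreal G * r v * (F (l v, l u) * r u)) \<in> borel_measurable (lborel \<Otimes>\<^sub>M lborel)"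
        unfolding split_beta by measurable
      from lborel_pair.Fubini'[OF this] show ?thesis by (simp only: prod.case)
    qed
    also have "\<dots> = (\<integral>\<^sup>+v. \<integral>\<^sup>+u. ennreal G * r v * (F (l u, l v) * r u) \<partial>lborel \<partial>lborel)"
      by (simp add: mult_ac)
    also have "\<dots> = ?R"
      unfolding gibbs_density k1 fun_upd_upd unfolding l_def[symmetric] r_def[symmetric]
      by (intro nn_integral_cong nn_integral_cmult) measurable
    finally show ?thesis .
  qed
  have 1: "(\<lambda>x. \<integral>\<^sup>+u. F (x, x(k := u)) * ennreal (rho V (x (k - 1)) (x (k + 1)) u) \<partial>lborel) \<in> borel_measurable S"
    by measurable
  have 2: "(\<lambda>x. \<integral>\<^sup>+u. F (x(k := u), x) * ennreal (rho V (x (k - 1)) (x (k + 1)) u) \<partial>lborel) \<in> borel_measurable S"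
    by measurable
  show ?thesis
    unfolding nn_integral_gibbs_section[OF k 1] nn_integral_gibbs_section[OF k 2]
    by (intro nn_integral_cong inner pin_in_Omega)
qed

lemma resampling:
  assumes k: "k \<in> {1..<N}"
  shows "reversible_resampling \<mu> (\<lambda>x. rho V (x (k - 1)) (x (k + 1))) (\<lambda>x u. x(k := u))"
proof -
  have [measurable]: "(\<lambda>x. x (k - 1)) \<in> borel_measurable S" "(\<lambda>x. x (k + 1)) \<in> borel_measurable S"
    using k by (auto intro!: measurable_coord)
  show ?thesis
  proof
    show "(\<lambda>(x, u). x(k := u)) \<in> measurable (\<mu> \<Otimes>\<^sub>M lborel) \<mu>"
      using measurable_upd[OF k] by (simp cong: measurable_cong_sets add: sets_gibbs)
    show "F \<in> borel_measurable (\<mu> \<Otimes>\<^sub>M \<mu>) \<Longrightarrow>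
      (\<integral>\<^sup>+x. \<integral>\<^sup>+u. F (x, x(k := u)) * ennreal (rho V (x (k - 1)) (x (k + 1)) u) \<partial>lborel \<partial>\<mu>)
      = (\<integral>\<^sup>+x. \<integral>\<^sup>+u. F (x(k := u), x) * ennreal (rho V (x (k - 1)) (x (k + 1)) u) \<partial>lborel \<partial>\<mu>)" for F
      by (rule gibbs_reversible[OF k]) (simp cong: measurable_cong_sets)
  qed (simp_all add: integrable_rho)
qed

end

section \<open>Contraction and the spectral gap\<close>

text \<open>Neighbour averaging is moved onto the sine weights, where the addition theorem makes it
  multiplication by \<open>cos (pi / N)\<close>. It is applied to
  \<open>d = \<bar>x - y\<bar>\<close> for the contraction and to \<open>d = x\<close> for the
  eigenfunction.\<close>

lemma sine_sum_by_parts: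
  fixes d :: "nat \<Rightarrow> real"
  assumes N: "N \<ge> 1" and d: "d 0 = 0" "d N = 0"
  shows "(\<Sum>k\<in>{1..<N}. sin (real k * pi / real N) * ((d (k - 1) + d (k + 1)) / 2))
    = cos (pi / real N) * (\<Sum>k\<in>{1..<N}. sin (real k * pi / real N) * d k)"
proof -
  define s where "s k = sin (real k * pi / real N)" for k
  have s0: "s 0 = 0" "s N = 0" using N by (simp_all add: s_def)
  obtain n where n: "N = Suc n" using N by (cases N) auto
  \<comment> \<open>After the shift the index runs from 0 to \<open>N - 2\<close>. The term at
    \<open>N - 1\<close> can be added since \<open>s N = 0\<close>, and the one at 0 removed since
    \<open>d 0 = 0\<close>.\<close>
  have A: "(\<Sum>k\<in>{1..<N}. s k * d (k - 1)) = (\<Sum>j\<in>{1..<N}. s (j + 1) * d j)"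
  proof -
    have "(\<Sum>k\<in>{1..<N}. s k * d (k - 1)) = (\<Sum>j\<in>{0..<n}. s (j + 1) * d j)"
      using sum.shift_bounds_Suc_ivl[of "\<lambda>k. s k * d (k - 1)" 0 n] by (simp add: n One_nat_def)
    also have "\<dots> = (\<Sum>j\<in>{0..<N}. s (j + 1) * d j)"
    proof (rule sum.mono_neutral_left)
      show "\<forall>i\<in>{0..<N} - {0..<n}. s (i + 1) * d i = 0"
      proof
        fix i assume "i \<in> {0..<N} - {0..<n}"
        then have "i + 1 = N" using n by auto
        then show "s (i + 1) * d i = 0" using s0 by simp
      qed
    qed (use n in auto)
    also have "\<dots> = (\<Sum>j\<in>{1..<N}. s (j + 1) * d j)"
    proof (rule sum.mono_neutral_right)
      show "\<forall>i\<in>{0..<N} - {1..<N}. s (i + 1) * d i = 0"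
      proof
        fix i assume "i \<in> {0..<N} - {1..<N}"
        then have "i = 0" by auto
        then show "s (i + 1) * d i = 0" using d by simp
      qed
    qed auto
    finally show ?thesis .
  qed
  \<comment> \<open>After the shift the index runs from 2 to \<open>N\<close>. The term at 1 can be
    added since \<open>s 0 = 0\<close>, and the one at \<open>N\<close> removed since
    \<open>d N = 0\<close>.\<close>
  have B: "(\<Sum>k\<in>{1..<N}. s k * d (k + 1)) = (\<Sum>j\<in>{1..<N}. s (j - 1) * d j)"
  proof -
    have "(\<Sum>k\<in>{1..<N}. s k * d (k + 1)) = (\<Sum>j\<in>{Suc 1..<Suc N}. s (j - 1) * d j)"
      by (subst sum.shift_bounds_Suc_ivl) (simp add: Suc_eq_plus1)
    also have "\<dots> = (\<Sum>j\<in>{1..<Suc N}. s (j - 1) * d j)"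
    proof (rule sum.mono_neutral_left)
      show "\<forall>i\<in>{1..<Suc N} - {Suc 1..<Suc N}. s (i - 1) * d i = 0"
      proof
        fix i assume "i \<in> {1..<Suc N} - {Suc 1..<Suc N}"
        then have "i = 1" by auto
        then show "s (i - 1) * d i = 0" using s0 by simp
      qed
    qed auto
    also have "\<dots> = (\<Sum>j\<in>{1..<N}. s (j - 1) * d j)"
    proof (rule sum.mono_neutral_right)
      show "\<forall>i\<in>{1..<Suc N} - {1..<N}. s (i - 1) * d i = 0"
      proof
        fix i assume "i \<in> {1..<Suc N} - {1..<N}"
        then have "i = N" by auto
        then show "s (i - 1) * d i = 0" using d by simp
      qed
    qed auto
    finally show ?thesis .
  qed
  have trig: "s (j + 1) + s (j - 1) = 2 * cos (pi / real N) * s j" if j: "j \<in> {1..<N}" for j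
  proof -
    have "s (j + 1) = sin (real j * pi / real N + pi / real N)"
      unfolding s_def by (intro arg_cong[where f = sin]) (simp add: add_divide_distrib distrib_right add.commute)
    moreover have "s (j - 1) = sin (real j * pi / real N - pi / real N)"
      unfolding s_def using j by (intro arg_cong[where f = sin]) (simp add: of_nat_diff diff_divide_distrib left_diff_distrib)
    ultimately show ?thesis by (simp add: sin_add sin_diff s_def)
  qed
  have "(\<Sum>k\<in>{1..<N}. s k * ((d (k - 1) + d (k + 1)) / 2))
      = ((\<Sum>k\<in>{1..<N}. s k * d (k - 1)) + (\<Sum>k\<in>{1..<N}. s k * d (k + 1))) / 2"
    by (simp add: sum.distrib[symmetric] sum_divide_distrib distrib_left)
  also have "\<dots> = (\<Sum>j\<in>{1..<N}. (s (j + 1) + s (j - 1)) * d j) / 2"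
    unfolding A B by (simp add: sum.distrib distrib_right)
  also have "\<dots> = (\<Sum>j\<in>{1..<N}. cos (pi / real N) * (s j * d j))"
    unfolding sum_divide_distrib by (intro sum.cong) (simp_all add: trig)
  also have "\<dots> = cos (pi / real N) * (\<Sum>j\<in>{1..<N}. s j * d j)"
    by (simp add: sum_distrib_left)
  finally show ?thesis by (simp add: s_def)
qed

context gibbs_sampler
begin

lemma
  assumes k: "k \<in> {1..<N}" and f: "f \<in> L2 \<mu>"
  shows resample_L2: "resample V k f \<in> L2 \<mu>"
    and l2norm_resample_le: "l2norm \<mu> (resample V k f) \<le> l2norm \<mu> f"
    and integral_resample: "(\<integral>x. resample V k f x \<partial>\<mu>) = (\<integral>x. f x \<partial>\<mu>)"
    and resample_add: "g \<in> L2 \<mu> \<Longrightarrow> AE x in \<mu>. resample V k (\<lambda>x. f x + g x) x = resample V k f x + resample V k g x"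
    and resample_symmetric: "g \<in> L2 \<mu> \<Longrightarrow>
      (\<integral>x. g x * resample V k f x \<partial>\<mu>) = (\<integral>x. resample V k g x * f x \<partial>\<mu>)"
proof -
  interpret R: reversible_resampling \<mu> "\<lambda>x. rho V (x (k - 1)) (x (k + 1))" "\<lambda>x u. x(k := u)"
    by (rule resampling[OF k])
  have Q: "R.Q h = resample V k h" for h by (simp add: R.Q_def resample_def fun_eq_iff)
  show "resample V k f \<in> L2 \<mu>" using R.Q_L2[OF f] by (simp add: Q)
  show "l2norm \<mu> (resample V k f) \<le> l2norm \<mu> f" using R.l2norm_Q_le[OF f] by (simp add: Q)
  show "(\<integral>x. resample V k f x \<partial>\<mu>) = (\<integral>x. f x \<partial>\<mu>)" using R.integral_Q_eq[OF f] by (simp add: Q)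
  show "AE x in \<mu>. resample V k (\<lambda>x. f x + g x) x = resample V k f x + resample V k g x"
    if "g \<in> L2 \<mu>" using R.Q_add[OF f that] by (simp add: Q)
  show "(\<integral>x. g x * resample V k f x \<partial>\<mu>) = (\<integral>x. resample V k g x * f x \<partial>\<mu>)"
    if "g \<in> L2 \<mu>" using R.Q_symmetric[OF f that] by (simp add: Q)
qed

definition T :: "((nat \<Rightarrow> real) \<Rightarrow> real) \<Rightarrow> (nat \<Rightarrow> real) \<Rightarrow> real" where
  "T f x = (\<Sum>k\<in>{1..<N}. resample V k f x)"

lemma atLeastAtMost_pred: "{1..N - 1} = {1..<N}"
  using N by auto

lemma generator_eq: "generator V N f x = T f x - (real N - 1) * f x"
  using N by (simp add: generator_def T_def sum_subtractf atLeastAtMost_pred of_nat_diff)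

lemma T_L2: "f \<in> L2 \<mu> \<Longrightarrow> T f \<in> L2 \<mu>"
  unfolding T_def[abs_def] by (intro L2_sum resample_L2)

lemma l2norm_T_le:
  assumes f: "f \<in> L2 \<mu>"
  shows "l2norm \<mu> (T f) \<le> (real N - 1) * l2norm \<mu> f"
proof -
  have "l2norm \<mu> (T f) \<le> (\<Sum>k\<in>{1..<N}. l2norm \<mu> (resample V k f))"
    unfolding T_def[abs_def] by (intro l2norm_sum resample_L2 f) auto
  also have "\<dots> \<le> (\<Sum>k\<in>{1..<N}. l2norm \<mu> f)" by (intro sum_mono l2norm_resample_le f)
  also have "\<dots> = (real N - 1) * l2norm \<mu> f" using N by (simp add: of_nat_diff)
  finally show ?thesis .
qed

lemma integral_T:
  assumes f: "f \<in> L2 \<mu>"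
  shows "(\<integral>x. T f x \<partial>\<mu>) = (real N - 1) * (\<integral>x. f x \<partial>\<mu>)"
proof -
  have "(\<integral>x. T f x \<partial>\<mu>) = (\<Sum>k\<in>{1..<N}. \<integral>x. resample V k f x \<partial>\<mu>)"
    unfolding T_def by (intro Bochner_Integration.integral_sum integrable_L2 resample_L2 f)
  also have "\<dots> = (\<Sum>k\<in>{1..<N}. \<integral>x. f x \<partial>\<mu>)" by (intro sum.cong refl integral_resample f)
  also have "\<dots> = (real N - 1) * (\<integral>x. f x \<partial>\<mu>)" using N by (simp add: of_nat_diff)
  finally show ?thesis .
qed

lemma T_add:
  assumes f: "f \<in> L2 \<mu>" and g: "g \<in> L2 \<mu>"
  shows "AE x in \<mu>. T (\<lambda>x. f x + g x) x = T f x + T g x"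
proof -
  have "AE x in \<mu>. \<forall>k\<in>{1..<N}. resample V k (\<lambda>x. f x + g x) x = resample V k f x + resample V k g x"
    by (intro AE_finite_allI resample_add f g) auto
  then show ?thesis by eventually_elim (simp add: T_def sum.distrib)
qed

lemma T_symmetric:
  assumes f: "f \<in> L2 \<mu>" and g: "g \<in> L2 \<mu>"
  shows "(\<integral>x. f x * T g x \<partial>\<mu>) = (\<integral>x. T f x * g x \<partial>\<mu>)"
proof -
  have "(\<integral>x. f x * T g x \<partial>\<mu>) = (\<Sum>k\<in>{1..<N}. \<integral>x. f x * resample V k g x \<partial>\<mu>)"
    unfolding T_def sum_distrib_left
    by (intro Bochner_Integration.integral_sum integrable_L2_mult resample_L2 f g)
  also have "\<dots> = (\<Sum>k\<in>{1..<N}. \<integral>x. resample V k f x * g x \<partial>\<mu>)"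
    by (intro sum.cong refl resample_symmetric f g)
  also have "\<dots> = (\<integral>x. T f x * g x \<partial>\<mu>)"
    unfolding T_def sum_distrib_right
    by (intro Bochner_Integration.integral_sum[symmetric] integrable_L2_mult resample_L2 f g)
  finally show ?thesis .
qed

section \<open>Contraction of the weighted Lipschitz constant\<close>

definition s :: "nat \<Rightarrow> real" where
  "s k = sin (real k * pi / real N)"

lemma s_pos: "k \<in> {1..<N} \<Longrightarrow> s k > 0"
  unfolding s_def by (intro sin_gt_zero) (auto simp: field_simps)

lemma s_nonneg: "k \<in> {1..<N} \<Longrightarrow> s k \<ge> 0"
  using s_pos[of k] by simp

lemma s_le_1: "s k \<le> 1"
  by (simp add: s_def)

definition wdist :: "(nat \<Rightarrow> real) \<Rightarrow> (nat \<Rightarrow> real) \<Rightarrow> real" where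
  "wdist x y = (\<Sum>j\<in>{1..<N}. s j * \<bar>x j - y j\<bar>)"

lemma wdist_remove:
  assumes k: "k \<in> {1..<N}"
  shows "wdist x y = s k * \<bar>x k - y k\<bar> + (\<Sum>j\<in>{1..<N} - {k}. s j * \<bar>x j - y j\<bar>)"
  unfolding wdist_def by (rule sum.remove[OF _ k]) simp

lemma wdist_upd:
  assumes k: "k \<in> {1..<N}"
  shows "wdist (x(k := u)) (y(k := v)) = wdist x y - s k * \<bar>x k - y k\<bar> + s k * \<bar>u - v\<bar>"
proof -
  have "(\<Sum>j\<in>{1..<N} - {k}. s j * \<bar>(x(k := u)) j - (y(k := v)) j\<bar>)
      = (\<Sum>j\<in>{1..<N} - {k}. s j * \<bar>x j - y j\<bar>)"
    by (intro sum.cong) auto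
  then show ?thesis using wdist_remove[OF k, of x y] wdist_remove[OF k, of "x(k := u)" "y(k := v)"] by simp
qed

text \<open>Measurability and the sign of \<open>C\<close> are carried along so that the class is
  preserved by \<open>T\<close> and its members are square-integrable. The estimate is required on
  \<open>Omega N\<close> only, where configurations agree at both ends.\<close>

definition Lip :: "real \<Rightarrow> ((nat \<Rightarrow> real) \<Rightarrow> real) \<Rightarrow> bool" where
  "Lip C f \<longleftrightarrow> 0 \<le> C \<and> f \<in> borel_measurable S \<and>
    (\<forall>x\<in>Omega N. \<forall>y\<in>Omega N. \<bar>f x - f y\<bar> \<le> C * wdist x y)"

lemma LipD:
  assumes "Lip C f"
  shows "0 \<le> C" "f \<in> borel_measurable S"
    "\<And>x y. x \<in> Omega N \<Longrightarrow> y \<in> Omega N \<Longrightarrow> \<bar>f x - f y\<bar> \<le> C * wdist x y"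
  using assms by (auto simp: Lip_def)

lemma Lip_section:
  assumes f: "Lip C f" and k: "k \<in> {1..<N}" and x: "x \<in> Omega N"
  shows "(\<lambda>u. f (x(k := u))) \<in> borel_measurable borel"
    and "\<bar>f (x(k := u)) - f (x(k := v))\<bar> \<le> C * s k * \<bar>u - v\<bar>"
proof -
  show "(\<lambda>u. f (x(k := u))) \<in> borel_measurable borel"
    using measurable_compose[OF measurable_line[OF k x] LipD(2)[OF f]] by simp
  have "\<bar>f (x(k := u)) - f (x(k := v))\<bar> \<le> C * wdist (x(k := u)) (x(k := v))"
    by (intro LipD(3)[OF f] upd_in_Omega x k)
  also have "wdist (x(k := u)) (x(k := v)) = s k * \<bar>u - v\<bar>"
    unfolding wdist_upd[OF k] by (simp add: wdist_def)
  finally show "\<bar>f (x(k := u)) - f (x(k := v))\<bar> \<le> C * s k * \<bar>u - v\<bar>" by (simp only: mult.assoc)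
qed

text \<open>Two sources of change are separated. Under the same density, both configurations receive
  the same value at \<open>k\<close>, so the \<open>k\<close>-th term of the distance disappears.
  Under the change of density, the section of \<open>f\<close> is Lipschitz with constant
  \<open>C * s k\<close>, and half of the neighbours' discrepancy enters with that weight.\<close>

lemma resample_Lipschitz:
  assumes f: "Lip C f" and k: "k \<in> {1..<N}" and x: "x \<in> Omega N" and y: "y \<in> Omega N"
  shows "\<bar>resample V k f x - resample V k f y\<bar> \<le> C * (wdist x y - s k * \<bar>x k - y k\<bar>
    + s k * ((\<bar>x (k - 1) - y (k - 1)\<bar> + \<bar>x (k + 1) - y (k + 1)\<bar>) / 2))"
proof -
  define E where "E = C * (wdist x y - s k * \<bar>x k - y k\<bar>)"
  let ?r = "rho V (x (k - 1)) (x (k + 1))" and ?r' = "rho V (y (k - 1)) (y (k + 1))"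
  define g h where "g u = f (y(k := u))" and "h u = f (x(k := u))" for u
  have g_meas [measurable]: "g \<in> borel_measurable borel"
    and h_meas [measurable]: "h \<in> borel_measurable borel"
    unfolding g_def[abs_def] h_def[abs_def] using Lip_section(1)[OF f k] x y by auto
  have g: "\<bar>g u - g v\<bar> \<le> C * s k * \<bar>u - v\<bar>" and h: "\<bar>h u - h v\<bar> \<le> C * s k * \<bar>u - v\<bar>" for u v
    unfolding g_def h_def using Lip_section(2)[OF f k] x y by auto
  have hg: "\<bar>h u - g u\<bar> \<le> E" for u
  proof -
    have "\<bar>h u - g u\<bar> \<le> C * wdist (x(k := u)) (y(k := u))"
      unfolding g_def h_def by (intro LipD(3)[OF f] upd_in_Omega x y k)
    then show ?thesis by (simp add: wdist_upd[OF k] E_def)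
  qed
  have int: "integrable lborel (\<lambda>u. h u * ?r u)" "integrable lborel (\<lambda>u. g u * ?r u)"
    using integrable_rho_Lipschitz[OF h_meas h] integrable_rho_Lipschitz[OF g_meas g] by auto
  have split: "resample V k f x - resample V k f y
      = (\<integral>u. h u * ?r u - g u * ?r u \<partial>lborel) + ((\<integral>u. g u * ?r u \<partial>lborel) - (\<integral>u. g u * ?r' u \<partial>lborel))"
    using int by (simp add: resample_def g_def h_def)
  have "\<bar>resample V k f x - resample V k f y\<bar> \<le> \<bar>\<integral>u. h u * ?r u - g u * ?r u \<partial>lborel\<bar>
      + \<bar>(\<integral>u. g u * ?r u \<partial>lborel) - (\<integral>u. g u * ?r' u \<partial>lborel)\<bar>"
    unfolding split by (rule abs_triangle_ineq)
  also have "\<dots> \<le> E + C * s k * (\<bar>x (k - 1) - y (k - 1)\<bar> + \<bar>x (k + 1) - y (k + 1)\<bar>) / 2"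
  proof (rule add_mono)
    have "\<bar>\<integral>u. h u * ?r u - g u * ?r u \<partial>lborel\<bar> \<le> (\<integral>u. \<bar>h u * ?r u - g u * ?r u\<bar> \<partial>lborel)"
      by (rule integral_abs_bound)
    also have "\<dots> \<le> (\<integral>u. E * ?r u \<partial>lborel)"
    proof (rule integral_mono)
      show "integrable lborel (\<lambda>u. \<bar>h u * ?r u - g u * ?r u\<bar>)" using int by simp
      show "integrable lborel (\<lambda>u. E * ?r u)" using integrable_rho by simp
      show "\<bar>h u * ?r u - g u * ?r u\<bar> \<le> E * ?r u" for u
      proof -
        have "\<bar>h u * ?r u - g u * ?r u\<bar> = \<bar>h u - g u\<bar> * ?r u"
          by (simp add: abs_mult flip: left_diff_distrib)
        also have "\<dots> \<le> E * ?r u" by (intro mult_right_mono hg) simp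
        finally show ?thesis .
      qed
    qed
    also have "\<dots> = E" by simp
    finally show "\<bar>\<integral>u. h u * ?r u - g u * ?r u \<partial>lborel\<bar> \<le> E" .
    show "\<bar>(\<integral>u. g u * ?r u \<partial>lborel) - (\<integral>u. g u * ?r' u \<partial>lborel)\<bar>
      \<le> C * s k * (\<bar>x (k - 1) - y (k - 1)\<bar> + \<bar>x (k + 1) - y (k + 1)\<bar>) / 2"
      by (rule rho_Lipschitz[OF g_meas g])
  qed
  also have "\<dots> = C * (wdist x y - s k * \<bar>x k - y k\<bar>
    + s k * ((\<bar>x (k - 1) - y (k - 1)\<bar> + \<bar>x (k + 1) - y (k + 1)\<bar>) / 2))"
    by (simp add: E_def algebra_simps)
  finally show ?thesis .
qed

definition q :: real where
  "q = real N - 2 + cos (pi / real N)"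

lemma q_nonneg: "0 \<le> q"
proof -
  have "pi / real N \<le> pi / 2" using N by (intro divide_left_mono) auto
  moreover have "- (pi / 2) \<le> pi / real N" by (rule order_trans[of _ 0]) auto
  ultimately have "0 \<le> cos (pi / real N)" by (intro cos_ge_zero) auto
  then show ?thesis using N by (simp add: q_def)
qed

lemma cos_less_1: "cos (pi / real N) < 1"
proof -
  have "pi / real N \<le> pi" using N by (simp add: field_simps)
  then have "cos (pi / real N) < cos 0" using N by (intro cos_monotone_0_pi) auto
  then show ?thesis by simp
qed

text \<open>Each of the \<open>N - 1\<close> updates keeps the distance except at its own site. Over
  all sites the erased terms sum to one full \<open>wdist\<close>, and the recreated neighbour
  averages to \<open>cos (pi / N)\<close> times it, which leaves
  \<open>N - 1 - 1 + cos (pi / N) = q\<close>.\<close>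

lemma Lip_T:
  assumes f: "Lip C f"
  shows "Lip (q * C) (T f)"
  unfolding Lip_def
proof (intro conjI ballI)
  show "0 \<le> q * C" using q_nonneg LipD(1)[OF f] by simp
  have "resample V k f \<in> borel_measurable S" if k: "k \<in> {1..<N}" for k
  proof -
    interpret R: reversible_resampling \<mu> "\<lambda>x. rho V (x (k - 1)) (x (k + 1))" "\<lambda>x u. x(k := u)"
      by (rule resampling[OF k])
    have "f \<in> borel_measurable \<mu>" using LipD(2)[OF f] by measurable
    then have "R.Q f \<in> borel_measurable \<mu>" by (rule R.measurable_Q)
    moreover have "R.Q f = resample V k f" by (simp add: R.Q_def resample_def fun_eq_iff)
    ultimately show ?thesis by (simp cong: measurable_cong_sets)
  qed
  then show "T f \<in> borel_measurable S" unfolding T_def[abs_def] by (rule borel_measurable_sum)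
  fix x y assume x: "x \<in> Omega N" and y: "y \<in> Omega N"
  define d where "d j = \<bar>x j - y j\<bar>" for j
  have d0: "d 0 = 0" "d N = 0" using x y by (auto simp: d_def Omega_def)
  have D: "(\<Sum>k\<in>{1..<N}. s k * d k) = wdist x y" by (simp add: wdist_def d_def)
  have "\<bar>T f x - T f y\<bar> = \<bar>\<Sum>k\<in>{1..<N}. resample V k f x - resample V k f y\<bar>"
    by (simp add: T_def sum_subtractf)
  also have "\<dots> \<le> (\<Sum>k\<in>{1..<N}. \<bar>resample V k f x - resample V k f y\<bar>)" by (rule sum_abs)
  also have "\<dots> \<le> (\<Sum>k\<in>{1..<N}. C * (wdist x y - s k * d k + s k * ((d (k - 1) + d (k + 1)) / 2)))"
    unfolding d_def by (intro sum_mono resample_Lipschitz f x y)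
  also have "\<dots> = C * ((\<Sum>k\<in>{1..<N}. wdist x y) - (\<Sum>k\<in>{1..<N}. s k * d k)
      + (\<Sum>k\<in>{1..<N}. s k * ((d (k - 1) + d (k + 1)) / 2)))"
    by (simp only: sum_distrib_left[symmetric] sum.distrib sum_subtractf)
  also have "(\<Sum>k\<in>{1..<N}. s k * ((d (k - 1) + d (k + 1)) / 2)) = cos (pi / real N) * wdist x y"
    using sine_sum_by_parts[of N d] N d0 D by (simp add: s_def)
  also have "C * ((\<Sum>k\<in>{1..<N}. wdist x y) - (\<Sum>k\<in>{1..<N}. s k * d k) + cos (pi / real N) * wdist x y)
      = q * C * wdist x y"
    unfolding D using N by (simp add: q_def of_nat_diff algebra_simps)
  finally show "\<bar>T f x - T f y\<bar> \<le> q * C * wdist x y" .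
qed

section \<open>From Lipschitz constants to L2 norms\<close>

definition l1 :: "(nat \<Rightarrow> real) \<Rightarrow> real" where
  "l1 x = (\<Sum>j\<in>{1..<N}. \<bar>x j\<bar>)"

lemma l1_nonneg: "0 \<le> l1 x"
  by (simp add: l1_def sum_nonneg)

lemma measurable_l1 [measurable]: "l1 \<in> borel_measurable S"
  unfolding l1_def[abs_def]
  by (intro borel_measurable_sum borel_measurable_abs measurable_coord) auto

lemma prob_Omega [simp]: "prob (Omega N) = 1"
  using prob_space by simp

lemma l1_L2: "l1 \<in> L2 \<mu>"
proof -
  have "integrable \<mu> (\<lambda>x. (l1 x)\<^sup>2)"
    unfolding gibbs_eq
  proof (subst integrable_density)
    show "integrable (reference_measure N) (\<lambda>x. gibbs_density x *\<^sub>R (l1 x)\<^sup>2)"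
    proof (rule Bochner_Integration.integrable_bound)
      show "integrable (reference_measure N)
        (\<lambda>x. (1 + (\<Sum>j\<in>{1..<N}. \<bar>x j\<bar>)\<^sup>2) * exp (- hamiltonian V N x) / partition_function V N)"
        by (intro integrable_divide integrable_moment)
      have "gibbs_density x * (l1 x)\<^sup>2 \<le> (1 + (l1 x)\<^sup>2) * exp (- hamiltonian V N x) / partition_function V N" for x
      proof -
        have "(l1 x)\<^sup>2 * gibbs_density x \<le> (1 + (l1 x)\<^sup>2) * gibbs_density x"
          using gibbs_density_pos[of x] by (intro mult_right_mono) auto
        then show ?thesis by (simp only: gibbs_density_def mult.commute times_divide_eq_right times_divide_eq_left)
      qed
      then have "norm (gibbs_density x *\<^sub>R (l1 x)\<^sup>2)
        \<le> norm ((1 + (\<Sum>j\<in>{1..<N}. \<bar>x j\<bar>)\<^sup>2) * exp (- hamiltonian V N x) / partition_function V N)" for x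
      proof -
        have "norm (gibbs_density x *\<^sub>R (l1 x)\<^sup>2) = gibbs_density x * (l1 x)\<^sup>2" using gibbs_density_pos[of x] by (simp add: abs_mult)
        also note \<open>\<And>x. gibbs_density x * (l1 x)\<^sup>2 \<le> (1 + (l1 x)\<^sup>2) * exp (- hamiltonian V N x) / partition_function V N\<close>
        finally show ?thesis unfolding l1_def real_norm_def by (rule order_trans[OF _ abs_ge_self])
      qed
      then show "AE x in reference_measure N. norm (gibbs_density x *\<^sub>R (l1 x)\<^sup>2)
        \<le> norm ((1 + (\<Sum>j\<in>{1..<N}. \<bar>x j\<bar>)\<^sup>2) * exp (- hamiltonian V N x) / partition_function V N)"
        by (rule AE_I2)
    qed measurable
  qed (use gibbs_density_pos in \<open>auto simp: less_imp_le\<close>)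
  then show ?thesis unfolding L2_def by simp
qed

lemma wdist_le: "wdist x y \<le> l1 x + l1 y"
  unfolding wdist_def l1_def sum.distrib[symmetric]
proof (rule sum_mono)
  fix j assume j: "j \<in> {1..<N}"
  have "s j * \<bar>x j - y j\<bar> \<le> 1 * \<bar>x j - y j\<bar>" by (intro mult_right_mono s_le_1) simp
  then show "s j * \<bar>x j - y j\<bar> \<le> \<bar>x j\<bar> + \<bar>y j\<bar>" by simp
qed

lemma Lip_L2:
  assumes f: "Lip C f"
  shows "f \<in> L2 \<mu>"
proof (rule L2_dominated)
  \<comment> \<open>The zero configuration serves as base point for the growth bound of
    \<open>f\<close>.\<close>
  define z where "z = pin N (\<lambda>_. 0)"
  show "(\<lambda>x. (\<bar>f z\<bar> + C * l1 z) + C * l1 x) \<in> L2 \<mu>"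
    by (intro L2_add L2_const L2_scale l1_L2)
  show "f \<in> borel_measurable \<mu>" using LipD(2)[OF f] by measurable
  fix x assume "x \<in> space \<mu>"
  then have "\<bar>f x - f z\<bar> \<le> C * wdist x z"
    by (intro LipD(3)[OF f]) (auto simp: z_def pin_in_Omega)
  also have "\<dots> \<le> C * (l1 x + l1 z)" by (intro mult_left_mono wdist_le LipD(1)[OF f])
  finally have "\<bar>f x\<bar> \<le> (\<bar>f z\<bar> + C * l1 z) + C * l1 x" by (simp add: distrib_left)
  then show "\<bar>f x\<bar> \<le> \<bar>(\<bar>f z\<bar> + C * l1 z) + C * l1 x\<bar>" by simp
qed

text \<open>For mean-zero \<open>f\<close>, the value \<open>f x\<close> is the average of
  \<open>f x - f y\<close> over \<open>y\<close>. So the Lipschitz constant bounds \<open>f\<close>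
  itself, with a fixed square-integrable envelope, and geometric decay of the constants becomes
  decay in L2.\<close>

lemma Lip_l2norm_le:
  assumes f: "Lip C f" and f0: "(\<integral>x. f x \<partial>\<mu>) = 0"
  shows "l2norm \<mu> f \<le> C * l2norm \<mu> (\<lambda>x. l1 x + (\<integral>y. l1 y \<partial>\<mu>))"
proof -
  let ?m = "\<integral>y. l1 y \<partial>\<mu>"
  note C = LipD(1)[OF f]
  have fint: "integrable \<mu> f" and lint: "integrable \<mu> l1"
    by (intro integrable_L2 Lip_L2[OF f], intro integrable_L2 l1_L2)
  have m: "0 \<le> ?m" by (simp add: l1_nonneg)
  have "l2norm \<mu> f \<le> l2norm \<mu> (\<lambda>x. C * (l1 x + ?m))"
  proof (rule l2norm_mono)
    show "(\<lambda>x. C * (l1 x + ?m)) \<in> L2 \<mu>" by (intro L2_scale L2_add L2_const l1_L2)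
    show "f \<in> borel_measurable \<mu>" using fint by blast
    fix x assume x: "x \<in> space \<mu>"
    have "f x = (\<integral>y. f x - f y \<partial>\<mu>)" using fint f0 by (simp add: prob_space)
    then have "\<bar>f x\<bar> \<le> (\<integral>y. \<bar>f x - f y\<bar> \<partial>\<mu>)"
      using integral_abs_bound[of \<mu> "\<lambda>y. f x - f y"] by simp
    also have "\<dots> \<le> (\<integral>y. C * (l1 x + l1 y) \<partial>\<mu>)"
    proof (rule integral_mono)
      fix y assume y: "y \<in> space \<mu>"
      have "\<bar>f x - f y\<bar> \<le> C * wdist x y" using x y by (intro LipD(3)[OF f]) auto
      also have "\<dots> \<le> C * (l1 x + l1 y)" by (intro mult_left_mono wdist_le C)
      finally show "\<bar>f x - f y\<bar> \<le> C * (l1 x + l1 y)" .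
    qed (use fint lint in auto)
    also have "\<dots> = C * (l1 x + ?m)" using lint by (simp add: prob_space)
    finally show "\<bar>f x\<bar> \<le> \<bar>C * (l1 x + ?m)\<bar>" by simp
  qed
  also have "\<dots> = C * l2norm \<mu> (\<lambda>x. l1 x + ?m)" using C by (simp add: l2norm_scale)
  finally show ?thesis .
qed

section \<open>Density of Lipschitz functions\<close>

text \<open>The coordinate half-spaces are a generator whose indicators are limits of ramps in a
  single coordinate. For the pinned coordinates these sets are empty or all of
  \<open>Omega N\<close>.\<close>

lemma sets_gibbs_generator:
  "sets \<mu> = sigma_sets (space \<mu>) {{x \<in> Omega N. x k < a} | k a. k \<le> N}"
proof -
  let ?G = "{{x \<in> Omega N. x k < a} | k a. k \<le> N}"
  let ?M = "sigma (Omega N) ?G"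
  have spM [simp]: "space ?M = Omega N" and stM: "sets ?M = sigma_sets (Omega N) ?G"
    by (auto intro!: space_measure_of sets_measure_of)
  have coord: "(\<lambda>x. x k) \<in> borel_measurable ?M" if "k \<le> N" for k
    unfolding borel_measurable_iff_less
  proof
    fix a
    have "{x \<in> Omega N. x k < a} \<in> ?G" using that by blast
    then show "{w \<in> space ?M. w k < a} \<in> sets ?M"
      unfolding spM stM by (rule sigma_sets.Basic)
  qed
  have id: "(\<lambda>x. x) \<in> measurable ?M S"
  proof (rule measurable_restrict_space2)
    show "(\<lambda>x. x) \<in> measurable ?M (Pi\<^sub>M {0..N} (\<lambda>_. borel))"
    proof (rule measurable_PiM_single')
      show "(\<lambda>x. x k) \<in> borel_measurable ?M" if "k \<in> {0..N}" for k
        using that by (intro coord) simp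
      show "(\<lambda>x k. x k) \<in> space ?M \<rightarrow> {0..N} \<rightarrow>\<^sub>E space borel"
        unfolding spM by (auto simp: Omega_def)
    qed
  qed (unfold spM, simp)
  have "A \<in> sigma_sets (Omega N) ?G" if A: "A \<in> sets S" for A
  proof -
    have "A \<subseteq> Omega N" using sets.sets_into_space[OF A] by simp
    then have "(\<lambda>x. x) -` A \<inter> space ?M = A" unfolding spM by auto
    then show ?thesis using measurable_sets[OF id A] unfolding stM by simp
  qed
  moreover have "sigma_sets (Omega N) ?G \<subseteq> sets S"
  proof -
    have "{x \<in> space S. x k < a} \<in> sets S" if "k \<le> N" for k a
      using measurable_coord[OF that] by measurable
    then have "?G \<subseteq> sets S" by auto
    then show ?thesis using sets.sigma_sets_subset[of ?G S] by simp
  qed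
  ultimately show ?thesis unfolding sets_gibbs by auto
qed

lemma Lip_dense:
  assumes f: "f \<in> L2 \<mu>" and e: "0 < e"
  shows "\<exists>g. (\<exists>C. Lip C g) \<and> l2norm \<mu> (\<lambda>x. f x - g x) < e"
proof -
  \<comment> \<open>Boundedness is added because products of unbounded Lipschitz functions need not
    be Lipschitz.\<close>
  define E where "E = {g. \<exists>B C. (\<forall>x\<in>Omega N. \<bar>g x\<bar> \<le> B) \<and> Lip C g}"
  have "\<exists>g\<in>E. l2norm \<mu> (\<lambda>x. f x - g x) < e"
  proof (rule L2_dense_of_generator[OF _ _ _ _ sets_gibbs_generator _ f e])
    show "(\<lambda>_. c) \<in> E" for c
    proof -
      have "Lip 0 (\<lambda>_. c)" by (simp add: Lip_def)
      then show ?thesis unfolding E_def by auto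
    qed
    show "E \<subseteq> L2 \<mu>" unfolding E_def by (auto intro: Lip_L2)
  next
    fix g h assume "g \<in> E" "h \<in> E"
    then obtain B C B' C' where g: "\<And>x. x \<in> Omega N \<Longrightarrow> \<bar>g x\<bar> \<le> B" "Lip C g"
      and h: "\<And>x. x \<in> Omega N \<Longrightarrow> \<bar>h x\<bar> \<le> B'" "Lip C' h"
      unfolding E_def by blast
    note [measurable] = LipD(2)[OF g(2)] LipD(2)[OF h(2)]
    have "0 \<le> \<bar>g (pin N (\<lambda>_. 0))\<bar>" "0 \<le> \<bar>h (pin N (\<lambda>_. 0))\<bar>" by auto
    then have B0: "0 \<le> B" "0 \<le> B'" using g(1) h(1) pin_in_Omega by (meson order_trans)+
    show "(\<lambda>x. g x + h x) \<in> E"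
      unfolding E_def mem_Collect_eq
    proof (intro exI conjI ballI)
      show "\<bar>g x + h x\<bar> \<le> B + B'" if "x \<in> Omega N" for x
        using g(1)[OF that] h(1)[OF that] by linarith
      show "Lip (C + C') (\<lambda>x. g x + h x)"
        unfolding Lip_def
      proof (intro conjI ballI)
        fix x y assume "x \<in> Omega N" "y \<in> Omega N"
        from LipD(3)[OF g(2) this] LipD(3)[OF h(2) this]
        show "\<bar>g x + h x - (g y + h y)\<bar> \<le> (C + C') * wdist x y"
          unfolding distrib_right by linarith
      qed (use LipD(1)[OF g(2)] LipD(1)[OF h(2)] in \<open>auto\<close>)
    qed
    show "(\<lambda>x. g x * h x) \<in> E"
      unfolding E_def mem_Collect_eq
    proof (intro exI conjI ballI)
      show "\<bar>g x * h x\<bar> \<le> B * B'" if "x \<in> Omega N" for x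
        unfolding abs_mult using g(1)[OF that] h(1)[OF that] B0 by (intro mult_mono) auto
      show "Lip (B * C' + B' * C) (\<lambda>x. g x * h x)"
        unfolding Lip_def
      proof (intro conjI ballI)
        fix x y assume xy: "x \<in> Omega N" "y \<in> Omega N"
        have "g x * h x - g y * h y = g x * (h x - h y) + h y * (g x - g y)"
          by (simp add: algebra_simps)
        then have "\<bar>g x * h x - g y * h y\<bar> \<le> \<bar>g x\<bar> * \<bar>h x - h y\<bar> + \<bar>h y\<bar> * \<bar>g x - g y\<bar>"
          using abs_triangle_ineq[of "g x * (h x - h y)" "h y * (g x - g y)"] by (simp add: abs_mult)
        also have "\<dots> \<le> B * (C' * wdist x y) + B' * (C * wdist x y)"
          using xy B0 by (intro add_mono mult_mono g h LipD(3)[OF g(2)] LipD(3)[OF h(2)]) auto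
        finally show "\<bar>g x * h x - g y * h y\<bar> \<le> (B * C' + B' * C) * wdist x y"
          by (simp add: algebra_simps)
      qed (use LipD(1)[OF g(2)] LipD(1)[OF h(2)] B0 in \<open>auto\<close>)
    qed
  next
    fix A :: "(nat \<Rightarrow> real) set" and e :: real
    assume "A \<in> {{x \<in> Omega N. x k < a} | k a. k \<le> N}" and e: "0 < e"
    then obtain k a where A: "A = {x \<in> Omega N. x k < a}" and k: "k \<le> N" by blast
    note [measurable] = measurable_coord[OF k]
    \<comment> \<open>A ramp of slope \<open>n\<close> that equals 0 outside the open half-space and
      reaches 1 at depth \<open>1 / n\<close> inside it; it converges pointwise to the
      indicator.\<close>
    define \<phi> where "\<phi> n x = max 0 (min 1 (real n * (a - x k)))" for n and x :: "nat \<Rightarrow> real"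
    have A_eq: "A = {x \<in> space S. x k < a}" by (simp add: A)
    have A_meas [measurable]: "A \<in> sets S" unfolding A_eq by measurable
    have [measurable]: "\<phi> n \<in> borel_measurable S" for n unfolding \<phi>_def[abs_def] by measurable
    have \<phi>01: "0 \<le> \<phi> n x" "\<phi> n x \<le> 1" for n x by (auto simp: \<phi>_def)
    have "(\<lambda>n. \<integral>x. \<bar>indicator A x - \<phi> n x\<bar> \<partial>\<mu>) \<longlonglongrightarrow> (\<integral>x. 0 \<partial>\<mu>)"
    proof (rule integral_dominated_convergence[where w = "\<lambda>_. 1"])
      show "AE x in \<mu>. (\<lambda>n. \<bar>indicator A x - \<phi> n x\<bar>) \<longlonglongrightarrow> 0"
      proof (rule AE_I2)
        fix x assume x: "x \<in> space \<mu>"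
        have "eventually (\<lambda>n. indicator A x = \<phi> n x) sequentially"
        proof (cases "x k < a")
          case True
          obtain m where m: "1 / (a - x k) < real m" using reals_Archimedean2 by blast
          have "indicator A x = \<phi> n x" if "n \<ge> m" for n
          proof -
            have "1 \<le> real m * (a - x k)" using m True by (simp add: field_simps)
            also have "\<dots> \<le> real n * (a - x k)" using True that by (intro mult_right_mono) auto
            finally show ?thesis using True x by (simp add: \<phi>_def A)
          qed
          then show ?thesis by (auto simp: eventually_sequentially)
        next
          case False
          then have nonpos: "real n * (a - x k) \<le> 0" for n by (simp add: mult_nonneg_nonpos)
          have "\<phi> n x = 0" for n unfolding \<phi>_def using nonpos[of n] by linarith
          then show ?thesis using False by (simp add: A)
        qed
        then have "eventually (\<lambda>n. 0 = \<bar>indicator A x - \<phi> n x\<bar>) sequentially"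
          by eventually_elim simp
        then show "(\<lambda>n. \<bar>indicator A x - \<phi> n x\<bar>) \<longlonglongrightarrow> 0" by (rule Lim_transform_eventually[OF tendsto_const])
      qed
      show "AE x in \<mu>. norm \<bar>indicator A x - \<phi> n x\<bar> \<le> 1" for n
        using \<phi>01[of n] by (auto split: split_indicator)
    qed auto
    then have "eventually (\<lambda>n. dist (\<integral>x. \<bar>indicator A x - \<phi> n x\<bar> \<partial>\<mu>) 0 < e) sequentially"
      using e by (intro tendstoD) auto
    then obtain n where n: "(\<integral>x. \<bar>indicator A x - \<phi> n x\<bar> \<partial>\<mu>) < e"
      by (auto simp: eventually_sequentially dist_real_def)
    have step: "\<bar>\<phi> n x - \<phi> n y\<bar> \<le> real n * \<bar>x k - y k\<bar>" for x y
    proof -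
      have "\<bar>\<phi> n x - \<phi> n y\<bar> \<le> \<bar>real n * (a - x k) - real n * (a - y k)\<bar>"
        unfolding \<phi>_def by (auto simp: max_def min_def)
      also have "\<dots> = real n * \<bar>x k - y k\<bar>"
        by (simp add: abs_mult abs_minus_commute flip: right_diff_distrib)
      finally show ?thesis .
    qed
    have "\<exists>C. Lip C (\<phi> n)"
    proof (cases "k \<in> {1..<N}")
      case True
      note sk = s_pos[OF True]
      \<comment> \<open>Division by \<open>s k\<close> compensates the weight of coordinate
        \<open>k\<close> in \<open>wdist\<close>; it is possible because interior weights are
        positive.\<close>
      have "Lip (real n / s k) (\<phi> n)"
        unfolding Lip_def
      proof (intro conjI ballI)
        fix x y
        have "0 \<le> (\<Sum>j\<in>{1..<N} - {k}. s j * \<bar>x j - y j\<bar>)"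
          by (intro sum_nonneg mult_nonneg_nonneg s_nonneg) auto
        then have "s k * \<bar>x k - y k\<bar> \<le> wdist x y"
          unfolding wdist_remove[OF True] by simp
        then have "real n * \<bar>x k - y k\<bar> \<le> real n / s k * wdist x y"
          using sk mult_left_mono[of "s k * \<bar>x k - y k\<bar>" "wdist x y" "real n / s k"] by simp
        with step[of x y] show "\<bar>\<phi> n x - \<phi> n y\<bar> \<le> real n / s k * wdist x y" by linarith
      qed (use sk in auto)
      then show ?thesis by blast
    next
      case False
      then have "k = 0 \<or> k = N" using k by auto
      then have xk: "x k = 0" if "x \<in> Omega N" for x using that by (auto simp: Omega_def)
      \<comment> \<open>At a pinned coordinate the ramp is constant on
        \<open>Omega N\<close>.\<close>
      have "Lip 0 (\<phi> n)" unfolding Lip_def by (simp add: \<phi>_def xk)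
      then show ?thesis by blast
    qed
    then have "\<phi> n \<in> E" unfolding E_def using \<phi>01[of n] by (auto intro!: exI[of _ 1])
    then show "\<exists>g\<in>E. (\<forall>x\<in>space \<mu>. 0 \<le> g x \<and> g x \<le> 1) \<and> (\<integral>x. \<bar>indicator A x - g x\<bar> \<partial>\<mu>) < e"
      using n \<phi>01 by blast
  qed
  then show ?thesis unfolding E_def by blast
qed

lemma l2norm_T_le_q:
  assumes f: "f \<in> L2 \<mu>" "(\<integral>x. f x \<partial>\<mu>) = 0"
  shows "l2norm \<mu> (T f) \<le> q * l2norm \<mu> f"
proof (rule symmetric_contraction_from_dense[where D = "{f. \<exists>C. Lip C f}" and K = "real N - 1"])
  show "\<exists>g\<in>{f. \<exists>C. Lip C f}. l2norm \<mu> (\<lambda>x. f x - g x) < e" if "f \<in> L2 \<mu>" "0 < e" for f e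
    using Lip_dense[OF that] by blast
  show "(\<lambda>x. f x - c) \<in> {f. \<exists>C. Lip C f}" if "f \<in> {f. \<exists>C. Lip C f}" for f c
  proof -
    obtain C where "Lip C f" using \<open>f \<in> {f. \<exists>C. Lip C f}\<close> by blast
    then have "Lip C (\<lambda>x. f x - c)" unfolding Lip_def by auto
    then show ?thesis by blast
  qed
  show "\<exists>C. \<forall>n. l2norm \<mu> ((T ^^ n) f) \<le> C * q ^ n"
    if fD: "f \<in> {f. \<exists>C. Lip C f}" and f0: "(\<integral>x. f x \<partial>\<mu>) = 0" for f
  proof -
    obtain C where C: "Lip C f" using fD by blast
    \<comment> \<open>The zero mean must survive the iteration, since the passage from Lipschitz
      constants to norms needs it at every \<open>n\<close>; \<open>T\<close> multiplies the mean by
      \<open>N - 1\<close>.\<close>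
    have iter: "Lip (q ^ n * C) ((T ^^ n) f) \<and> (\<integral>x. (T ^^ n) f x \<partial>\<mu>) = 0" for n
    proof (induction n)
      case 0
      show ?case using C f0 by simp
    next
      case (Suc n)
      then show ?case
        using Lip_T[of "q ^ n * C" "(T ^^ n) f"] integral_T[OF Lip_L2, of "q ^ n * C" "(T ^^ n) f"]
        by (simp add: mult.assoc)
    qed
    have "l2norm \<mu> ((T ^^ n) f) \<le> (C * l2norm \<mu> (\<lambda>x. l1 x + (\<integral>y. l1 y \<partial>\<mu>))) * q ^ n" for n
      using Lip_l2norm_le[of "q ^ n * C" "(T ^^ n) f"] iter[of n] by (simp add: mult_ac)
    then show ?thesis by blast
  qed
qed (use N q_nonneg f T_L2 l2norm_T_le T_symmetric T_add Lip_L2 in auto)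

section \<open>The sine mode and the value of the gap\<close>

lemma measurable_sine_mode [measurable]: "sine_mode N \<in> borel_measurable S"
  unfolding sine_mode_def[abs_def]
  by (intro borel_measurable_sum borel_measurable_times borel_measurable_const measurable_coord) auto

lemma sine_mode_eq: "sine_mode N x = (\<Sum>k\<in>{1..<N}. s k * x k)"
  by (simp add: sine_mode_def s_def atLeastAtMost_pred)

lemma sine_mode_upd:
  assumes k: "k \<in> {1..<N}"
  shows "sine_mode N (x(k := u)) = sine_mode N x - s k * x k + s k * u"
proof -
  have *: "sine_mode N z = s k * z k + (\<Sum>j\<in>{1..<N} - {k}. s j * z j)" for z
    unfolding sine_mode_eq by (rule sum.remove[OF _ k]) simp
  have "(\<Sum>j\<in>{1..<N} - {k}. s j * (x(k := u)) j) = (\<Sum>j\<in>{1..<N} - {k}. s j * x j)"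
    by (intro sum.cong) auto
  then show ?thesis using *[of x] *[of "x(k := u)"] by simp
qed

lemma Lip_sine_mode: "Lip 1 (sine_mode N)"
  unfolding Lip_def
proof (intro conjI ballI)
  fix x y
  have "\<bar>sine_mode N x - sine_mode N y\<bar> = \<bar>\<Sum>k\<in>{1..<N}. s k * (x k - y k)\<bar>"
    by (simp add: sine_mode_eq sum_subtractf right_diff_distrib)
  also have "\<dots> \<le> (\<Sum>k\<in>{1..<N}. \<bar>s k * (x k - y k)\<bar>)" by (rule sum_abs)
  also have "\<dots> = 1 * wdist x y"
    unfolding wdist_def mult_1 by (intro sum.cong refl) (simp add: abs_mult s_pos less_imp_le)
  finally show "\<bar>sine_mode N x - sine_mode N y\<bar> \<le> 1 * wdist x y" .
qed auto

text \<open>The sine mode is affine in the resampled height, so only the mean of \<open>rho\<close>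
  matters. This is why the result does not depend on the shape of \<open>V\<close>.\<close>

lemma resample_sine_mode:
  assumes k: "k \<in> {1..<N}"
  shows "resample V k (sine_mode N) x = sine_mode N x - s k * x k + s k * ((x (k - 1) + x (k + 1)) / 2)"
proof -
  let ?r = "rho V (x (k - 1)) (x (k + 1))"
  have "resample V k (sine_mode N) x
      = (\<integral>u. (sine_mode N x - s k * x k) * ?r u + s k * (u * ?r u) \<partial>lborel)"
    unfolding resample_def sine_mode_upd[OF k]
    by (intro Bochner_Integration.integral_cong) (auto simp: algebra_simps)
  also have "\<dots> = (sine_mode N x - s k * x k) * 1 + s k * ((x (k - 1) + x (k + 1)) / 2)"
    using integrable_rho[of "x (k - 1)" "x (k + 1)"] integrable_id_rho[of "x (k - 1)" "x (k + 1)"]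
    by (simp add: mean_rho)
  finally show ?thesis by simp
qed

lemma T_sine_mode:
  assumes x: "x \<in> Omega N"
  shows "T (sine_mode N) x = q * sine_mode N x"
proof -
  have x0: "x 0 = 0" "x N = 0" using x by (auto simp: Omega_def)
  have "T (sine_mode N) x = (\<Sum>k\<in>{1..<N}. sine_mode N x) - (\<Sum>k\<in>{1..<N}. s k * x k)
      + (\<Sum>k\<in>{1..<N}. s k * ((x (k - 1) + x (k + 1)) / 2))"
    unfolding T_def by (simp only: resample_sine_mode sum.distrib sum_subtractf cong: sum.cong)
  also have "(\<Sum>k\<in>{1..<N}. s k * ((x (k - 1) + x (k + 1)) / 2)) = cos (pi / real N) * sine_mode N x"
    using sine_sum_by_parts[of N x] N x0 by (simp add: s_def sine_mode_eq)
  finally show ?thesis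
    unfolding sine_mode_eq[symmetric] using N by (simp add: q_def of_nat_diff algebra_simps)
qed

lemma generator_sine_mode:
  assumes "x \<in> Omega N"
  shows "generator V N (sine_mode N) x = - (1 - cos (pi / real N)) * sine_mode N x"
  by (simp add: generator_eq T_sine_mode[OF assms] q_def algebra_simps)

text \<open>\<open>T\<close> multiplies integrals by \<open>N - 1\<close> but the sine mode by
  \<open>q < N - 1\<close>, so the integral must vanish. In other words, eigenfunctions for distinct
  eigenvalues of a symmetric operator are orthogonal, the constants being the other one.\<close>

lemma integral_sine_mode: "(\<integral>x. sine_mode N x \<partial>\<mu>) = 0"
proof -
  have "(real N - 1) * (\<integral>x. sine_mode N x \<partial>\<mu>) = (\<integral>x. T (sine_mode N) x \<partial>\<mu>)"
    by (rule integral_T[OF Lip_L2[OF Lip_sine_mode], symmetric])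
  also have "\<dots> = (\<integral>x. q * sine_mode N x \<partial>\<mu>)"
    by (intro Bochner_Integration.integral_cong) (auto simp: T_sine_mode)
  also have "\<dots> = q * (\<integral>x. sine_mode N x \<partial>\<mu>)" by simp
  finally have "(1 - cos (pi / real N)) * (\<integral>x. sine_mode N x \<partial>\<mu>) = 0"
    by (simp add: q_def algebra_simps)
  then show ?thesis using cos_less_1 by simp
qed

text \<open>By invariance of \<^term>\<open>\<mu>\<close> under resampling of the first coordinate, an almost surely vanishing
  sine mode would vanish almost everywhere on a line on which it is affine and not constant.\<close>

lemma sine_mode_nonzero: "\<not> (AE x in \<mu>. sine_mode N x = 0)"
proof
  assume AE0: "AE x in \<mu>. sine_mode N x = 0"
  have k: "1 \<in> {1..<N}" using N by auto
  interpret R: reversible_resampling \<mu> "\<lambda>x. rho V (x (1 - 1)) (x (1 + 1))" "\<lambda>x u. x(1 := u)"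
    by (rule resampling[OF k])
  let ?h = "\<lambda>x. ennreal ((sine_mode N x)\<^sup>2)"
  have h [measurable]: "?h \<in> borel_measurable \<mu>" by measurable
  have "(\<integral>\<^sup>+x. \<integral>\<^sup>+u. ?h (x(1 := u)) * ennreal (rho V (x (1 - 1)) (x (1 + 1)) u) \<partial>lborel \<partial>\<mu>) = (\<integral>\<^sup>+x. ?h x \<partial>\<mu>)"
    by (rule R.invariant[OF h])
  also have "\<dots> = 0" using AE0 by (subst nn_integral_0_iff_AE) auto
  finally have "AE x in \<mu>. (\<integral>\<^sup>+u. ?h (x(1 := u)) * ennreal (rho V (x (1 - 1)) (x (1 + 1)) u) \<partial>lborel) = 0"
    by (subst (asm) nn_integral_0_iff_AE) measurable
  then have "AE x in \<mu>. x \<in> Omega N \<and> (\<integral>\<^sup>+u. ?h (x(1 := u)) * ennreal (rho V (x (1 - 1)) (x (1 + 1)) u) \<partial>lborel) = 0"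
    using AE_space by eventually_elim simp
  then obtain x where x: "x \<in> Omega N"
    and 0: "(\<integral>\<^sup>+u. ?h (x(1 := u)) * ennreal (rho V (x (1 - 1)) (x (1 + 1)) u) \<partial>lborel) = 0"
    using eventually_happens'[OF ae_filter_bot] by blast
  define c where "c = sine_mode N x - s 1 * x 1"
  have upd: "sine_mode N (x(1 := u)) = c + s 1 * u" for u
    by (simp add: sine_mode_upd[OF k] c_def)
  have "AE u in lborel. ennreal ((c + s 1 * u)\<^sup>2) * ennreal (rho V (x (1 - 1)) (x (1 + 1)) u) = 0"
    using 0 measurable_ennreal_rho unfolding upd by (subst (asm) nn_integral_0_iff_AE) auto
  \<comment> \<open>Strict positivity of \<open>rho\<close> turns a null set for the conditional law
    into a Lebesgue null set.\<close>
  then have "AE u in lborel. c + s 1 * u = 0"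
    by eventually_elim (auto simp: ennreal_eq_0_iff not_le[THEN iffD2, OF rho_pos])
  moreover have "AE u in lborel. u \<noteq> - c / s 1" by (rule AE_lborel_singleton)
  ultimately have "AE u in (lborel :: real measure). False"
  proof eventually_elim
    case (elim u)
    then show ?case using s_pos[OF k] by (simp add: field_simps)
  qed
  then show False by (simp add: trivial_limit_def[symmetric] Measure_Space.ae_filter_eq_bot_iff)
qed

lemma integral_square_pos:
  assumes f: "f \<in> L2 \<mu>" and "\<not> (AE x in \<mu>. f x = 0)"
  shows "(\<integral>x. (f x)\<^sup>2 \<partial>\<mu>) > 0"
proof -
  have "(\<integral>x. (f x)\<^sup>2 \<partial>\<mu>) \<noteq> 0"
    using assms(2) integral_nonneg_eq_0_iff_AE[OF L2_D(2)[OF f]] by simp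
  moreover have "(\<integral>x. (f x)\<^sup>2 \<partial>\<mu>) \<ge> 0" by simp
  ultimately show ?thesis unfolding less_le by metis
qed

lemma spectral_gap_eq: "spectral_gap V N = ereal (1 - cos (pi / real N))"
proof (rule antisym)
  let ?f = "sine_mode N"
  have fL: "?f \<in> L2 \<mu>" by (rule Lip_L2[OF Lip_sine_mode])
  have "(\<integral>x. ?f x * (- generator V N ?f x) \<partial>\<mu>) = (\<integral>x. (1 - cos (pi / real N)) * (?f x)\<^sup>2 \<partial>\<mu>)"
    by (intro Bochner_Integration.integral_cong) (auto simp: generator_sine_mode power2_eq_square algebra_simps)
  then have "(\<integral>x. ?f x * (- generator V N ?f x) \<partial>\<mu>) / (\<integral>x. (?f x)\<^sup>2 \<partial>\<mu>) = 1 - cos (pi / real N)"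
    using integral_square_pos[OF fL sine_mode_nonzero] by simp
  then show "spectral_gap V N \<le> ereal (1 - cos (pi / real N))"
    unfolding spectral_gap_def using fL sine_mode_nonzero integral_sine_mode
    by (intro INF_lower2[of ?f]) auto
next
  show "ereal (1 - cos (pi / real N)) \<le> spectral_gap V N"
    unfolding spectral_gap_def
  proof (rule INF_greatest)
    fix f assume "f \<in> {f \<in> L2 \<mu>. \<not> (AE x in \<mu>. f x = 0) \<and> (\<integral>x. f x \<partial>\<mu>) = 0}"
    then have f: "f \<in> L2 \<mu>" "\<not> (AE x in \<mu>. f x = 0)" "(\<integral>x. f x \<partial>\<mu>) = 0" by auto
    have pos: "(\<integral>x. (f x)\<^sup>2 \<partial>\<mu>) > 0" by (rule integral_square_pos[OF f(1,2)])
    have "(\<integral>x. f x * T f x \<partial>\<mu>) \<le> l2norm \<mu> f * l2norm \<mu> (T f)"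
      using Cauchy_Schwarz_L2[OF f(1) T_L2[OF f(1)]] by linarith
    also have "\<dots> \<le> l2norm \<mu> f * (q * l2norm \<mu> f)"
      by (intro mult_left_mono l2norm_T_le_q f) simp
    also have "\<dots> = q * (l2norm \<mu> f)\<^sup>2" by (simp add: power2_eq_square)
    also have "\<dots> = q * (\<integral>x. (f x)\<^sup>2 \<partial>\<mu>)" by (simp only: l2norm_sq)
    finally have le: "(\<integral>x. f x * T f x \<partial>\<mu>) \<le> q * (\<integral>x. (f x)\<^sup>2 \<partial>\<mu>)" .
    have "(\<integral>x. f x * (- generator V N f x) \<partial>\<mu>) = (\<integral>x. (real N - 1) * (f x)\<^sup>2 - f x * T f x \<partial>\<mu>)"
      by (intro Bochner_Integration.integral_cong) (auto simp: generator_eq power2_eq_square algebra_simps)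
    also have "\<dots> = (real N - 1) * (\<integral>x. (f x)\<^sup>2 \<partial>\<mu>) - (\<integral>x. f x * T f x \<partial>\<mu>)"
      using L2_D(2)[OF f(1)] integrable_L2_mult[OF f(1) T_L2[OF f(1)]] by simp
    \<comment> \<open>Here \<open>N - 1 - q = 1 - cos (pi / N)\<close>.\<close>
    finally have "(1 - cos (pi / real N)) * (\<integral>x. (f x)\<^sup>2 \<partial>\<mu>) \<le> (\<integral>x. f x * (- generator V N f x) \<partial>\<mu>)"
      using le by (simp add: q_def algebra_simps)
    then show "ereal (1 - cos (pi / real N))
        \<le> ereal ((\<integral>x. f x * (- generator V N f x) \<partial>\<mu>) / (\<integral>x. (f x)\<^sup>2 \<partial>\<mu>))"
      using pos by (simp only: ereal_less_eq pos_le_divide_eq)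
  qed
qed

lemma eigenfunction_sine_mode:
  "eigenfunction V N (- (1 - cos (pi / real N))) (sine_mode N)"
  unfolding eigenfunction_def
proof (intro conjI)
  show "sine_mode N \<in> L2 \<mu>" by (rule Lip_L2[OF Lip_sine_mode])
  show "AE x in \<mu>. generator V N (sine_mode N) x = - (1 - cos (pi / real N)) * sine_mode N x"
    by (rule AE_I2) (simp add: generator_sine_mode)
qed (rule sine_mode_nonzero)

end

theorem theorem1p1:
  fixes V :: "real \<Rightarrow> real" and N :: nat
  assumes "V \<in> potentials" and "N \<ge> 2"
  shows "spectral_gap V N = ereal (1 - cos (pi / real N))
    \<and> eigenfunction V N (- real_of_ereal (spectral_gap V N)) (sine_mode N)"
proof -
  interpret gibbs_sampler V N by unfold_locales fact+
  show ?thesis using spectral_gap_eq eigenfunction_sine_mode by simp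
qed

end
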